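(* Let $F$ be a field of characteristic zero and let $E$ be the infinite-dimensional Grassmann algebra over $F$ endowed with the $\mathbb{Z}_2$-grading induced by $\deg(\cdot)_\infty$. Then for any positive integers $d_1,\dots,d_m$, \[T_{\mathbb{Z}_2}(UT(d_1,\dots,d_m;E))=T_{\mathbb{Z}_2}(M_{d_1}(E))\cdots T_{\mathbb{Z}_2}(M_{d_m}(E)).\]
   Context: $E$ is the unitary algebra generated by $e_1,e_2,\dots$ subject to $e_ie_j=-e_je_i$ for all $i,j$; it has basis $1$ and $e_{i_1}\cdots e_{i_k}$ ($i_1<\cdots<i_k$). The grading $\deg(\cdot)_\infty$ assigns $e_i$ degree $1\in\mathbb{Z}_2$ if $i$ is odd and $0$ if $i$ is even, and $e_{i_1}\cdots e_{i_k}$ degree $\deg(e_{i_1})+\cdots+\deg(e_{i_k})$. For a $\mathbb{Z}_2$-graded algebra $R$, $T_{\mathbb{Z}_2}(R)$ is the ideal of graded polynomial identities in the free algebra $F\langle Y\cup Z\rangle$, where $Y$ (resp. $Z$) is a countable set of variables of degree $0$ (resp. $1$); products of such ideals are usual ideal products. $UT(d_1,\dots,d_m;E)$ is the algebra of block upper-triangular matrices in $M_{d_1+\cdots+d_m}(E)$ with $(r,s)$ block ($r\le s$) arbitrary $d_r\times d_s$ over $E$ and zero blocks below the diagonal; it and each $M_d(E)$ are $\mathbb{Z}_2$-graded by letting the degree-$g$ component consist of matrices all of whose entries have degree $g$. *)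

theory Defs
  imports Main
begin

text \<open>An element of E is represented by its coordinate function with respect to the
basis e_S = e_{i_1}...e_{i_k} (S = {i_1 < ... < i_k} a finite set of positive integers;
S = {} gives 1).  Only finitely many coordinates are nonzero.\<close>

type_synonym 'a grass = "nat set \<Rightarrow> 'a"

definition grass_carrier :: "('a::field) grass set" where
  "grass_carrier = {x. finite {S. x S \<noteq> 0} \<and> (\<forall>S. x S \<noteq> 0 \<longrightarrow> finite S \<and> 0 \<notin> S)}"

definition gzero :: "('a::field) grass" where
  "gzero = (\<lambda>S. 0)"

definition gone :: "('a::field) grass" where
  "gone = (\<lambda>S. if S = {} then 1 else 0)"

definition gadd :: "('a::field) grass \<Rightarrow> 'a grass \<Rightarrow> 'a grass" where
  "gadd x y = (\<lambda>S. x S + y S)"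

definition ggen :: "nat \<Rightarrow> ('a::field) grass" where
  "ggen i = (\<lambda>S. if S = {i} then 1 else 0)"

text \<open>Sign with e_S e_T = gsign S T e_{S \<union> T} for disjoint S, T (number of inversions).\<close>
definition gsign :: "nat set \<Rightarrow> nat set \<Rightarrow> 'a::field" where
  "gsign S T = (-1) ^ card {(s,t). s \<in> S \<and> t \<in> T \<and> t < s}"

text \<open>Multiplication: e_S e_T = 0 if S, T meet, and gsign S T e_{S \<union> T} otherwise.\<close>
definition gmult :: "('a::field) grass \<Rightarrow> 'a grass \<Rightarrow> 'a grass" where
  "gmult x y = (\<lambda>U. if finite U then (\<Sum>S\<in>Pow U. gsign S (U - S) * x S * y (U - S)) else 0)"

text \<open>Homogeneous component of degree b (b = True means degree 1 in Z_2) for the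
grading deg_\<infinity>: e_i has degree 1 iff i is odd.\<close>
definition grass_deg :: "bool \<Rightarrow> ('a::field) grass set" where
  "grass_deg b = {x \<in> grass_carrier. \<forall>S. x S \<noteq> 0 \<longrightarrow> odd (card {i \<in> S. odd i}) = b}"

type_synonym 'a gmat = "nat \<Rightarrow> nat \<Rightarrow> 'a grass"

definition mat_carrier :: "nat \<Rightarrow> ('a::field) gmat set" where
  "mat_carrier n = {A. \<forall>i j. A i j \<in> grass_carrier \<and> ((i \<ge> n \<or> j \<ge> n) \<longrightarrow> A i j = gzero)}"

definition mzero :: "('a::field) gmat" where
  "mzero = (\<lambda>i j. gzero)"

definition mone :: "nat \<Rightarrow> ('a::field) gmat" where
  "mone n = (\<lambda>i j. if i = j \<and> i < n then gone else gzero)"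

definition mmult :: "nat \<Rightarrow> ('a::field) gmat \<Rightarrow> 'a gmat \<Rightarrow> 'a gmat" where
  "mmult n A B = (\<lambda>i j S. if i < n \<and> j < n then (\<Sum>k<n. gmult (A i k) (B k j) S) else 0)"

definition mdeg :: "bool \<Rightarrow> ('a::field) gmat set \<Rightarrow> 'a gmat set" where
  "mdeg b R = {A \<in> R. \<forall>i j. A i j \<in> grass_deg b}"

text \<open>Block index of row/column i for block sizes ds = [d_1,...,d_m] (0-based).\<close>
definition blk :: "nat list \<Rightarrow> nat \<Rightarrow> nat" where
  "blk ds i = (LEAST r. i < sum_list (take (Suc r) ds))"

definition UT :: "nat list \<Rightarrow> ('a::field) gmat set" where
  "UT ds = {A \<in> mat_carrier (sum_list ds). \<forall>i j. blk ds j < blk ds i \<longrightarrow> A i j = gzero}"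

text \<open>Variables: Inl k is y_k (degree 0), Inr k is z_k (degree 1).  A noncommutative
polynomial is a finitely supported coefficient function on words (monomials).\<close>

type_synonym 'a ncpoly = "(nat + nat) list \<Rightarrow> 'a"

definition free_alg :: "('a::field) ncpoly set" where
  "free_alg = {f. finite {w. f w \<noteq> 0}}"

definition pzero :: "('a::field) ncpoly" where
  "pzero = (\<lambda>w. 0)"

definition padd :: "('a::field) ncpoly \<Rightarrow> 'a ncpoly \<Rightarrow> 'a ncpoly" where
  "padd f g = (\<lambda>w. f w + g w)"

definition pmult :: "('a::field) ncpoly \<Rightarrow> 'a ncpoly \<Rightarrow> 'a ncpoly" where
  "pmult f g = (\<lambda>w. \<Sum>i\<le>length w. f (take i w) * g (drop i w))"

definition mword :: "nat \<Rightarrow> ((nat + nat) \<Rightarrow> ('a::field) gmat) \<Rightarrow> (nat + nat) list \<Rightarrow> 'a gmat" where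
  "mword n \<phi> w = foldr (\<lambda>x M. mmult n (\<phi> x) M) w (mone n)"

definition peval :: "nat \<Rightarrow> ((nat + nat) \<Rightarrow> ('a::field) gmat) \<Rightarrow> 'a ncpoly \<Rightarrow> 'a gmat" where
  "peval n \<phi> f = (\<lambda>i j S. \<Sum>w\<in>{w. f w \<noteq> 0}. f w * mword n \<phi> w i j S)"

definition graded_subst :: "('a::field) gmat set \<Rightarrow> ((nat + nat) \<Rightarrow> 'a gmat) \<Rightarrow> bool" where
  "graded_subst R \<phi> \<longleftrightarrow> (\<forall>k. \<phi> (Inl k) \<in> mdeg False R \<and> \<phi> (Inr k) \<in> mdeg True R)"

definition TZ2 :: "nat \<Rightarrow> ('a::field) gmat set \<Rightarrow> 'a ncpoly set" where
  "TZ2 n R = {f \<in> free_alg. \<forall>\<phi>. graded_subst R \<phi> \<longrightarrow> peval n \<phi> f = mzero}"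

inductive_set iprod :: "('a::field) ncpoly set \<Rightarrow> 'a ncpoly set \<Rightarrow> 'a ncpoly set"
  for I J where
  iprod_zero: "pzero \<in> iprod I J"
| iprod_add: "\<lbrakk>a \<in> I; b \<in> J; h \<in> iprod I J\<rbrakk> \<Longrightarrow> padd (pmult a b) h \<in> iprod I J"

fun iprods :: "('a::field) ncpoly set list \<Rightarrow> 'a ncpoly set" where
  "iprods [] = free_alg"
| "iprods [I] = I"
| "iprods (I # Is) = iprod I (iprods Is)"

end

theory Submission
  imports Defs "HOL.Vector_Spaces" "HOL-Library.Function_Algebras"
begin

text \<open>By induction it suffices to split off the first block, i.e. to show
  \<open>T(UT(d, ds)) = I J\<close> with \<open>I = T(M\<^sub>d(E))\<close> and \<open>J = T(UT(ds))\<close>.  Both \<open>I\<close> and \<open>J\<close> are the common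
  kernels of the functionals which read off a Grassmann coordinate of a matrix entry of an
  evaluation.  Evaluating an identity \<open>f\<close> of \<open>UT(d, ds)\<close> on block matrices whose diagonal blocks
  use disjoint sets of Grassmann generators, and whose corner is a single matrix unit, shows that
  \<open>\<Sum> f\<^sub>w \<kappa>(u) \<mu>(v) = 0\<close> (sum over \<open>w = u x v\<close>) for each letter \<open>x\<close> and all functionals \<open>\<kappa>\<close>, \<open>\<mu>\<close>
  belonging to \<open>I\<close>, \<open>J\<close>.  By Lewin's argument this orthogonality forces \<open>f \<in> I J\<close>.\<close>

text \<open>The library instances make polynomials an additive group, but their pointwise simp rules
  eta-expand sums of polynomials.\<close>

declare plus_fun_apply [simp del] zero_fun_apply [simp del]

lemmas pointwise = plus_fun_apply zero_fun_apply fun_diff_def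

section \<open>Polynomials as vectors, and functionals given by their values on words\<close>

definition pscale :: "'a::field \<Rightarrow> 'a ncpoly \<Rightarrow> 'a ncpoly" where
  "pscale c f = (\<lambda>w. c * f w)"

definition pword :: "(nat + nat) list \<Rightarrow> ('a::field) ncpoly" where
  "pword u = (\<lambda>w. if w = u then 1 else 0)"

text \<open>Words form a basis of the free algebra, so an arbitrary function \<open>\<mu>\<close> on
  words encodes a linear functional, of which this is the value at \<open>f\<close>.\<close>

definition pairing :: "((nat + nat) list \<Rightarrow> 'a::field) \<Rightarrow> 'a ncpoly \<Rightarrow> 'a" where
  "pairing \<mu> f = (\<Sum>w\<in>{w. f w \<noteq> 0}. f w * \<mu> w)"

lemma padd_eq_plus: "padd f g = f + g"
  by (simp add: padd_def plus_fun_def)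

lemma pzero_eq_0: "pzero = 0"
  by (simp add: pzero_def zero_fun_def)

text \<open>The ambient space consists of all coefficient functions, also those of infinite support;
  the free algebra is its subspace \<open>free_alg\<close>. This is why additivity of
  \<open>pairing\<close> carries membership hypotheses.\<close>

interpretation ncpoly: vector_space "pscale :: 'a::field \<Rightarrow> 'a ncpoly \<Rightarrow> 'a ncpoly"
  by unfold_locales (simp_all add: pscale_def fun_eq_iff pointwise algebra_simps)

lemma sum_fun_apply: "(\<Sum>i\<in>A. f i) x = (\<Sum>i\<in>A. f i x)"
  for f :: "'i \<Rightarrow> 'b \<Rightarrow> 'c::comm_monoid_add"
  by (induction A rule: infinite_finite_induct) (auto simp: pointwise)

lemma subspace_free_alg: "ncpoly.subspace (free_alg :: 'a::field ncpoly set)"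
proof (rule ncpoly.subspaceI)
  show "(0 :: 'a ncpoly) \<in> free_alg" by (simp add: free_alg_def pointwise)
next
  fix f g :: "'a ncpoly" assume "f \<in> free_alg" "g \<in> free_alg"
  then have "finite ({w. f w \<noteq> 0} \<union> {w. g w \<noteq> 0})" by (simp add: free_alg_def)
  then show "f + g \<in> free_alg"
    unfolding free_alg_def by (auto simp: pointwise simp del: finite_Un elim!: finite_subset[rotated])
next
  fix c and f :: "'a ncpoly" assume "f \<in> free_alg"
  then show "pscale c f \<in> free_alg"
    unfolding free_alg_def pscale_def by (auto elim!: finite_subset[rotated])
qed

lemma pword_free_alg: "pword u \<in> free_alg"
  by (simp add: free_alg_def pword_def)

lemma ncpoly_eq_sum_pword:
  assumes "f \<in> free_alg"
  shows "f = (\<Sum>w\<in>{w. f w \<noteq> 0}. pscale (f w) (pword w))"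
proof
  fix v
  have "finite {w. f w \<noteq> 0}" using assms by (simp add: free_alg_def)
  then have "(\<Sum>w\<in>{w. f w \<noteq> 0}. f w * pword w v) = f v"
    by (simp add: pword_def if_distrib[of "(*) _"] cong: if_cong)
  then show "f v = (\<Sum>w\<in>{w. f w \<noteq> 0}. pscale (f w) (pword w)) v"
    by (simp add: sum_fun_apply pscale_def)
qed

lemma pairing_superset:
  assumes "finite A" "{w. f w \<noteq> 0} \<subseteq> A"
  shows "pairing \<mu> f = (\<Sum>w\<in>A. f w * \<mu> w)"
  unfolding pairing_def by (rule sum.mono_neutral_left) (use assms in auto)

lemma pairing_0 [simp]: "pairing \<mu> 0 = 0"
  by (simp add: pairing_def pointwise)

lemma pairing_add:
  assumes "f \<in> free_alg" "g \<in> free_alg"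
  shows "pairing \<mu> (f + g) = pairing \<mu> f + pairing \<mu> g"
proof -
  let ?A = "{w. f w \<noteq> 0} \<union> {w. g w \<noteq> 0}"
  have A: "finite ?A" using assms by (simp add: free_alg_def)
  have "pairing \<mu> (f + g) = (\<Sum>w\<in>?A. (f + g) w * \<mu> w)"
    by (rule pairing_superset[OF A]) (auto simp: pointwise)
  moreover have "pairing \<mu> f = (\<Sum>w\<in>?A. f w * \<mu> w)" "pairing \<mu> g = (\<Sum>w\<in>?A. g w * \<mu> w)"
    by (rule pairing_superset[OF A]; auto)+
  ultimately show ?thesis by (simp add: sum.distrib pointwise algebra_simps)
qed

lemma pairing_scale: "pairing \<mu> (pscale c f) = c * pairing \<mu> f"
  by (cases "c = 0") (simp_all add: pairing_def pscale_def sum_distrib_left mult.assoc)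

lemma pairing_scale_left: "pairing (\<lambda>w. c * \<mu> w) f = c * pairing \<mu> f"
  by (simp add: pairing_def sum_distrib_left mult.left_commute)

lemma pairing_pword [simp]: "pairing \<mu> (pword w) = \<mu> w"
  by (simp add: pairing_def pword_def)

lemma pairing_sum:
  assumes "\<And>i. i \<in> A \<Longrightarrow> f i \<in> free_alg"
  shows "pairing \<mu> (\<Sum>i\<in>A. f i) = (\<Sum>i\<in>A. pairing \<mu> (f i))"
  using assms
proof (induction A rule: infinite_finite_induct)
  case (insert a A)
  then have "(\<Sum>i\<in>A. f i) \<in> free_alg"
    by (intro ncpoly.subspace_sum subspace_free_alg) auto
  then show ?case using insert by (simp add: pairing_add)
qed auto

lemma subspace_pairing_kernel:
  "ncpoly.subspace {f \<in> free_alg. \<forall>\<mu>\<in>M. pairing \<mu> f = 0}"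
  using subspace_free_alg
  by (auto simp: ncpoly.subspace_def pairing_add pairing_scale)

subsection \<open>Products of noncommutative polynomials\<close>

lemma pmult_add_left: "pmult (f + g) h = pmult f h + pmult g h"
  by (simp add: pmult_def fun_eq_iff pointwise sum.distrib algebra_simps)

lemma pmult_add_right: "pmult h (f + g) = pmult h f + pmult h g"
  by (simp add: pmult_def fun_eq_iff pointwise sum.distrib algebra_simps)

lemma pmult_0 [simp]: "pmult 0 h = 0" "pmult h 0 = 0"
  by (simp_all add: pmult_def fun_eq_iff pointwise)

lemma pmult_scale: "pmult (pscale c f) h = pscale c (pmult f h)"
  "pmult h (pscale c f) = pscale c (pmult h f)"
  by (simp_all add: pmult_def pscale_def fun_eq_iff sum_distrib_left mult.assoc mult.left_commute)

lemma pmult_diff_left: "pmult (f - g) h = pmult f h - pmult g h"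
  by (simp add: pmult_def fun_eq_iff pointwise sum_subtractf algebra_simps)

lemma pmult_sum_left: "pmult (\<Sum>i\<in>A. f i) h = (\<Sum>i\<in>A. pmult (f i) h)"
  by (induction A rule: infinite_finite_induct) (simp_all add: pmult_add_left)

lemma pmult_sum_right: "pmult h (\<Sum>i\<in>A. f i) = (\<Sum>i\<in>A. pmult h (f i))"
  by (induction A rule: infinite_finite_induct) (simp_all add: pmult_add_right)

lemma pmult_pword: "pmult (pword u) (pword v) = pword (u @ v)"
proof
  fix w
  have *: "pword u (take i w) * pword v (drop i w) = (if i = length u \<and> w = u @ v then 1 else 0 :: 'a)"
    if "i \<le> length w" for i
    using that by (auto simp: pword_def)
  have "pmult (pword u) (pword v) w = (\<Sum>i\<le>length w. if i = length u \<and> w = u @ v then 1 else 0 :: 'a)"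
    unfolding pmult_def by (intro sum.cong refl *) auto
  also have "\<dots> = pword (u @ v) w"
    by (cases "w = u @ v") (auto simp: pword_def)
  finally show "pmult (pword u) (pword v) w = (pword (u @ v) w :: 'a)" .
qed

lemma pmult_expand:
  assumes "f \<in> free_alg" "g \<in> free_alg"
  shows "pmult f g = (\<Sum>u\<in>{u. f u \<noteq> 0}. \<Sum>v\<in>{v. g v \<noteq> 0}. pscale (f u * g v) (pword (u @ v)))"
proof -
  have "pmult f g = pmult (\<Sum>u\<in>{u. f u \<noteq> 0}. pscale (f u) (pword u)) (\<Sum>v\<in>{v. g v \<noteq> 0}. pscale (g v) (pword v))"
    using ncpoly_eq_sum_pword[OF assms(1)] ncpoly_eq_sum_pword[OF assms(2)] by simp
  then show ?thesis
    by (simp add: pmult_sum_left pmult_sum_right pmult_scale pmult_pword ncpoly.scale_sum_right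
        mult.commute sum.swap[of _ "{u. f u \<noteq> 0}"])
qed

lemma pmult_free_alg:
  assumes "f \<in> free_alg" "g \<in> free_alg"
  shows "pmult f g \<in> free_alg"
  unfolding pmult_expand[OF assms]
  by (intro ncpoly.subspace_sum subspace_free_alg ncpoly.subspace_scale pword_free_alg)

lemma pairing_pmult:
  assumes "f \<in> free_alg" "g \<in> free_alg"
  shows "pairing \<mu> (pmult f g) = (\<Sum>u\<in>{u. f u \<noteq> 0}. \<Sum>v\<in>{v. g v \<noteq> 0}. f u * g v * \<mu> (u @ v))"
proof -
  have "(\<Sum>v\<in>{v. g v \<noteq> 0}. pscale (f u * g v) (pword (u @ v))) \<in> free_alg" for u
    by (intro ncpoly.subspace_sum subspace_free_alg ncpoly.subspace_scale pword_free_alg)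
  then show ?thesis
    unfolding pmult_expand[OF assms]
    by (simp add: pairing_sum pairing_scale ncpoly.subspace_scale[OF subspace_free_alg] pword_free_alg)
qed

lemma pmult_pword_assoc:
  assumes "f \<in> free_alg"
  shows "pmult (pmult f (pword u)) (pword v) = pmult f (pword (u @ v))"
proof -
  have "pmult (pmult (\<Sum>w\<in>{w. f w \<noteq> 0}. pscale (f w) (pword w)) (pword u)) (pword v)
      = pmult (\<Sum>w\<in>{w. f w \<noteq> 0}. pscale (f w) (pword w)) (pword (u @ v))"
    by (simp add: pmult_sum_left pmult_scale pmult_pword)
  then show ?thesis using ncpoly_eq_sum_pword[OF assms] by simp
qed

lemma pmult_Nil_right:
  assumes "f \<in> free_alg"
  shows "pmult f (pword []) = f"
proof -
  have "pmult (\<Sum>w\<in>{w. f w \<noteq> 0}. pscale (f w) (pword w)) (pword [])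
      = (\<Sum>w\<in>{w. f w \<noteq> 0}. pscale (f w) (pword w))"
    by (simp add: pmult_sum_left pmult_scale pmult_pword)
  then show ?thesis using ncpoly_eq_sum_pword[OF assms] by simp
qed

section \<open>Products of ideals and Lewin's criterion\<close>

lemma iprod_plus:
  assumes "g \<in> iprod I J" "h \<in> iprod I J"
  shows "g + h \<in> iprod I J"
  using assms
proof (induction g)
  case (iprod_add a b g)
  then have "padd (pmult a b) (g + h) \<in> iprod I J" by (intro iprod.iprod_add) auto
  then show ?case by (simp add: padd_eq_plus add.assoc)
qed (simp add: pzero_eq_0)

lemma iprod_mult: "\<lbrakk>a \<in> I; b \<in> J\<rbrakk> \<Longrightarrow> pmult a b \<in> iprod I J"
  using iprod.iprod_add[OF _ _ iprod.iprod_zero] by (fastforce simp: padd_eq_plus pzero_eq_0)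

lemma iprod_sum:
  assumes "\<And>i. i \<in> A \<Longrightarrow> f i \<in> iprod I J"
  shows "(\<Sum>i\<in>A. f i) \<in> iprod I J"
  using assms
  by (induction A rule: infinite_finite_induct)
    (auto simp: iprod_plus iprod.iprod_zero[unfolded pzero_eq_0])

text \<open>Extend a basis \<open>B\<close> of \<open>I\<close> to a basis \<open>C\<close> of the
  free algebra and keep only the coordinates at \<open>C - B\<close>: they vanish on
  \<open>I\<close>, and what they leave out is a combination of elements of \<open>B\<close>. They
  describe a projection along \<open>I\<close> onto a complement.\<close>

lemma complement_coordinates:
  fixes I :: "'a::field ncpoly set"
  assumes I: "ncpoly.subspace I" "I \<subseteq> free_alg"
  obtains c :: "'a ncpoly \<Rightarrow> 'a ncpoly \<Rightarrow> 'a" where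
    "\<And>f g n. f \<in> free_alg \<Longrightarrow> g \<in> free_alg \<Longrightarrow> c (f + g) n = c f n + c g n"
    "\<And>a f n. f \<in> free_alg \<Longrightarrow> c (pscale a f) n = a * c f n"
    "\<And>f. finite {n. c f n \<noteq> 0}"
    "\<And>f n. c f n \<noteq> 0 \<Longrightarrow> n \<in> free_alg"
    "\<And>f n. f \<in> I \<Longrightarrow> c f n = 0"
    "\<And>f. f \<in> free_alg \<Longrightarrow> f - (\<Sum>n\<in>{n. c f n \<noteq> 0}. pscale (c f n) n) \<in> I"
proof -
  obtain B where B: "B \<subseteq> I" "ncpoly.independent B" "I \<subseteq> ncpoly.span B"
    by (rule ncpoly.basis_exists[of I], rule that)
  obtain C where C: "B \<subseteq> C" "C \<subseteq> free_alg" "ncpoly.independent C" "free_alg \<subseteq> ncpoly.span C"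
    by (rule ncpoly.maximal_independent_subset_extend[OF order_trans[OF B(1) I(2)] B(2)], rule that)
  define c where "c f n = (if n \<in> C - B then ncpoly.representation C f n else 0)" for f n
  have fin: "finite {n. c f n \<noteq> 0}" for f
    by (rule finite_subset[OF _ ncpoly.finite_representation[of C f]]) (auto simp: c_def)
  show thesis
  proof (rule that[of c])
    show "c f n = 0" if "f \<in> I" for f n
    proof -
      have "ncpoly.representation C f = ncpoly.representation B f"
        by (rule ncpoly.representation_extend) (use B C that in auto)
      then show ?thesis
        using ncpoly.representation_ne_zero[of B f n] by (auto simp: c_def)
    qed
    show "f - (\<Sum>n\<in>{n. c f n \<noteq> 0}. pscale (c f n) n) \<in> I" if f: "f \<in> free_alg" for f
    proof -
      let ?r = "ncpoly.representation C f"
      let ?A = "{n. ?r n \<noteq> 0}"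
      have A: "finite ?A" by (rule ncpoly.finite_representation)
      have "f = (\<Sum>n\<in>?A. pscale (?r n) n)"
        using ncpoly.sum_nonzero_representation_eq[OF C(3), of f] f C(4) by auto
      also have "\<dots> = (\<Sum>n\<in>?A \<inter> B. pscale (?r n) n) + (\<Sum>n\<in>?A - B. pscale (?r n) n)"
        using A by (metis (no_types, lifting) sum.Int_Diff)
      also have "(\<Sum>n\<in>?A - B. pscale (?r n) n) = (\<Sum>n\<in>{n. c f n \<noteq> 0}. pscale (c f n) n)"
        using ncpoly.representation_ne_zero[of C f] by (intro sum.cong) (auto simp: c_def)
      finally have "f - (\<Sum>n\<in>{n. c f n \<noteq> 0}. pscale (c f n) n) = (\<Sum>n\<in>?A \<inter> B. pscale (?r n) n)"
        unfolding diff_eq_eq .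
      also have "\<dots> \<in> I"
        using B(1) by (intro ncpoly.subspace_sum ncpoly.subspace_scale I) auto
      finally show ?thesis .
    qed
    show "c (f + g) n = c f n + c g n" if "f \<in> free_alg" "g \<in> free_alg" for f g n
      using ncpoly.representation_add[OF C(3) subsetD[OF C(4)] subsetD[OF C(4)], of g f] that
      by (simp add: c_def)
    show "c (pscale a f) n = a * c f n" if "f \<in> free_alg" for a f n
      using ncpoly.representation_scale[OF C(3) subsetD[OF C(4)], of f a] that
      by (simp add: c_def)
    show "n \<in> free_alg" if "c f n \<noteq> 0" for f n
      using that C(2) by (auto simp: c_def split: if_splits)
  qed (rule fin)
qed

text \<open>The core of Lewin's theorem.  With \<open>\<pi>\<close> a projection of the free algebra along \<open>I\<close>,
  the word \<open>w = x\<^sub>1\<dots>x\<^sub>m\<close> telescopes as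
  \<open>w - \<pi> w = (1 - \<pi> 1) w + \<Sum>\<^sub>k (\<pi> (x\<^sub>1\<dots>x\<^sub>k\<^sub>-\<^sub>1) x\<^sub>k - \<pi> (x\<^sub>1\<dots>x\<^sub>k)) x\<^sub>k\<^sub>+\<^sub>1\<dots>x\<^sub>m\<close>; sorting the bracketed
  elements of \<open>I\<close> by the coordinates of \<open>\<pi> (x\<^sub>1\<dots>x\<^sub>k\<^sub>-\<^sub>1)\<close> and the letter \<open>x\<^sub>k\<close>, the orthogonality
  hypothesis puts the right cofactors into \<open>J\<close>.\<close>

lemma orthogonal_in_iprod:
  fixes L M :: "((nat + nat) list \<Rightarrow> 'a::field) set"
  defines "I \<equiv> {f \<in> free_alg. \<forall>\<kappa>\<in>L. pairing \<kappa> f = 0}"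
    and "J \<equiv> {f \<in> free_alg. \<forall>\<mu>\<in>M. pairing \<mu> f = 0}"
  assumes right: "\<And>f x. f \<in> I \<Longrightarrow> pmult f (pword [x]) \<in> I"
    and fI: "f \<in> I" and fJ: "f \<in> J"
    and orth: "\<And>x \<kappa> \<mu>. \<kappa> \<in> L \<Longrightarrow> \<mu> \<in> M \<Longrightarrow>
      pairing (\<lambda>w. \<Sum>k<length w. if w ! k = x then \<kappa> (take k w) * \<mu> (drop (Suc k) w) else 0) f = 0"
  shows "f \<in> iprod I J"
proof -
  have I: "ncpoly.subspace I" "I \<subseteq> free_alg"
    unfolding I_def by (rule subspace_pairing_kernel) auto
  note free = ncpoly.subspace_sum[OF subspace_free_alg] ncpoly.subspace_scale[OF subspace_free_alg]
    ncpoly.subspace_diff[OF subspace_free_alg] pword_free_alg pmult_free_alg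
  obtain c :: "'a ncpoly \<Rightarrow> 'a ncpoly \<Rightarrow> 'a" where
    c_add: "\<And>f g n. f \<in> free_alg \<Longrightarrow> g \<in> free_alg \<Longrightarrow> c (f + g) n = c f n + c g n" and
    c_scale: "\<And>a f n. f \<in> free_alg \<Longrightarrow> c (pscale a f) n = a * c f n" and
    c_fin: "\<And>f. finite {n. c f n \<noteq> 0}" and
    c_free: "\<And>f n. c f n \<noteq> 0 \<Longrightarrow> n \<in> free_alg" and
    c_I: "\<And>f n. f \<in> I \<Longrightarrow> c f n = 0" and
    c_diff: "\<And>f. f \<in> free_alg \<Longrightarrow> f - (\<Sum>n\<in>{n. c f n \<noteq> 0}. pscale (c f n) n) \<in> I"
    by (rule complement_coordinates[OF I], rule that)
  define \<pi> where "\<pi> g = (\<Sum>n\<in>{n. c g n \<noteq> 0}. pscale (c g n) n)" for g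
  have \<pi>_superset: "\<pi> g = (\<Sum>n\<in>A. pscale (c g n) n)" if "finite A" "{n. c g n \<noteq> 0} \<subseteq> A" for g A
    unfolding \<pi>_def by (rule sum.mono_neutral_left) (use that in auto)
  have \<pi>_free: "\<pi> g \<in> free_alg" for g
    unfolding \<pi>_def using c_free by (intro free) auto
  have \<pi>_diff: "g - \<pi> g \<in> I" if "g \<in> free_alg" for g
    using c_diff[OF that] by (simp add: \<pi>_def)
  have \<pi>_add: "\<pi> (g + h) = \<pi> g + \<pi> h" if "g \<in> free_alg" "h \<in> free_alg" for g h
  proof -
    let ?A = "{n. c g n \<noteq> 0} \<union> {n. c h n \<noteq> 0}"
    have "finite ?A" using c_fin by auto
    moreover have "{n. c (g + h) n \<noteq> 0} \<subseteq> ?A" using c_add[OF that] by auto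
    ultimately have "\<pi> (g + h) = (\<Sum>n\<in>?A. pscale (c (g + h) n) n)"
      "\<pi> g = (\<Sum>n\<in>?A. pscale (c g n) n)" "\<pi> h = (\<Sum>n\<in>?A. pscale (c h n) n)"
      by (intro \<pi>_superset; auto)+
    then show ?thesis
      by (simp add: c_add[OF that] ncpoly.scale_left_distrib sum.distrib)
  qed
  have \<pi>_scale: "\<pi> (pscale a g) = pscale a (\<pi> g)" if "g \<in> free_alg" for a g
  proof -
    have "\<pi> (pscale a g) = (\<Sum>n\<in>{n. c g n \<noteq> 0}. pscale (c (pscale a g) n) n)"
      by (rule \<pi>_superset[OF c_fin]) (auto simp: c_scale[OF that])
    then show ?thesis
      by (simp add: c_scale[OF that] \<pi>_def ncpoly.scale_sum_right)
  qed
  have \<pi>_0: "\<pi> g = 0" if "g \<in> I" for g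
    using c_I[OF that] by (simp add: \<pi>_def)
  have \<pi>_sum: "\<pi> (\<Sum>i\<in>A. g i) = (\<Sum>i\<in>A. \<pi> (g i))" if "\<And>i. i \<in> A \<Longrightarrow> g i \<in> free_alg"
    for A :: "'i set" and g
    using that
    by (induction A rule: infinite_finite_induct)
      (auto simp: \<pi>_add free \<pi>_0 ncpoly.subspace_0[OF I(1)])
  have c_sum: "c (\<Sum>i\<in>A. g i) n = (\<Sum>i\<in>A. c (g i) n)" if "\<And>i. i \<in> A \<Longrightarrow> g i \<in> free_alg"
    for A :: "'i set" and g n
    using that
    by (induction A rule: infinite_finite_induct)
      (auto simp: c_add free c_I ncpoly.subspace_0[OF I(1)])
  \<comment> \<open>These are the left factors of the final expansion. The bracket belonging to a
    prefix \<open>u\<close> and the next letter \<open>x\<close> is the combination of the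
    \<open>b n x\<close> weighted by the coordinates of \<open>\<pi> u\<close>.\<close>
  define b where "b n x = pmult n (pword [x]) - \<pi> (pmult n (pword [x]))" for n x
  have bI: "b n x \<in> I" if "n \<in> free_alg" for n x
    unfolding b_def by (intro \<pi>_diff free that)

  let ?W = "{w. f w \<noteq> 0}"
  have f: "f \<in> free_alg" using fI I by auto
  then have W: "finite ?W" by (simp add: free_alg_def)
  \<comment> \<open>\<open>N\<close> and \<open>X\<close> are finite sets that hold every basis
    element met by a prefix of a word of \<open>f\<close> and every letter of \<open>f\<close>, so
    that all words share the same index sets.\<close>
  define N where "N = (\<Union>w\<in>?W. \<Union>k\<le>length w. {n. c (pword (take k w)) n \<noteq> 0})"
  have N: "finite N" "N \<subseteq> free_alg"
    using W c_fin c_free by (auto simp: N_def)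
  define X where "X = (\<Union>w\<in>?W. set w)"
  have X: "finite X" using W by (auto simp: X_def)
  \<comment> \<open>The right cofactor of \<open>b n x\<close>: each occurrence of \<open>x\<close>
    in a word of \<open>f\<close> contributes the suffix after it, weighted by the coordinate at
    \<open>n\<close> of the prefix before it.\<close>
  define G where "G n x = (\<Sum>w\<in>?W. pscale (f w) (\<Sum>k<length w.
      pscale (if w ! k = x then c (pword (take k w)) n else 0) (pword (drop (Suc k) w))))" for n x

  have GJ: "G n x \<in> J" for n x
  proof -
    have "pairing \<mu> (G n x) = 0" if \<mu>: "\<mu> \<in> M" for \<mu>
    proof -
      \<comment> \<open>Dual to \<open>G\<close>: here the suffixes are evaluated by
        \<open>\<mu>\<close> and the prefixes are kept. Orthogonality says that every
        \<open>\<kappa>\<close> kills \<open>D\<close>, so \<open>D\<close> lies in \<open>I\<close>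
        and has zero coordinates; its coordinate at \<open>n\<close> is the pairing of
        \<open>\<mu>\<close> with \<open>G n x\<close>.\<close>
      define D where "D = (\<Sum>w\<in>?W. pscale (f w) (\<Sum>k<length w.
        pscale (if w ! k = x then \<mu> (drop (Suc k) w) else 0) (pword (take k w))))"
      have "pairing \<kappa> D = 0" if "\<kappa> \<in> L" for \<kappa>
      proof -
        have "pairing \<kappa> D = pairing (\<lambda>w. \<Sum>k<length w. if w ! k = x then \<kappa> (take k w) * \<mu> (drop (Suc k) w) else 0) f"
          unfolding D_def pairing_def[of _ f]
          by (auto simp: pairing_sum pairing_scale free intro!: sum.cong)
        then show ?thesis using orth[OF that \<mu>] by simp
      qed
      then have "D \<in> I" by (auto simp: I_def D_def intro!: free)
      then have "c D n = 0" by (rule c_I)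
      moreover have "pairing \<mu> (G n x) = c D n"
        unfolding D_def G_def
        by (auto simp: pairing_sum pairing_scale free c_sum c_scale intro!: sum.cong)
      ultimately show ?thesis by simp
    qed
    then show ?thesis by (auto simp: J_def G_def intro!: free)
  qed

  have step: "pmult (\<pi> (pword (take k w))) (pword [w ! k]) - \<pi> (pword (take (Suc k) w))
      = (\<Sum>n\<in>N. pscale (c (pword (take k w)) n) (b n (w ! k)))" if "w \<in> ?W" "k < length w" for w k
  proof -
    let ?u = "pword (take k w) :: 'a ncpoly" and ?x = "pword [w ! k] :: 'a ncpoly"
    have u: "\<pi> ?u = (\<Sum>n\<in>N. pscale (c ?u n) n)"
      by (rule \<pi>_superset[OF N(1)]) (use that in \<open>auto simp: N_def intro!: exI[of _ w] bexI[of _ k]\<close>)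
    \<comment> \<open>As \<open>I\<close> absorbs letters on the right,
      \<open>\<pi> (u x) = \<pi> (\<pi> u x)\<close>. Expanding the inner \<open>\<pi> u\<close> in
      coordinates turns the bracket into a combination of the \<open>b n x\<close>.\<close>
    have "?u - \<pi> ?u \<in> I" by (intro \<pi>_diff free)
    then have "\<pi> (pmult (?u - \<pi> ?u) ?x) = 0" by (intro \<pi>_0 right)
    moreover have "pmult ?u ?x = pmult (?u - \<pi> ?u) ?x + pmult (\<pi> ?u) ?x"
      by (simp flip: pmult_add_left)
    then have "\<pi> (pmult ?u ?x) = \<pi> (pmult (?u - \<pi> ?u) ?x) + \<pi> (pmult (\<pi> ?u) ?x)"
      by (simp add: \<pi>_add free \<pi>_free)
    moreover have "pmult ?u ?x = pword (take (Suc k) w)"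
      using that by (simp add: pmult_pword take_Suc_conv_app_nth)
    ultimately have "\<pi> (pword (take (Suc k) w)) = \<pi> (pmult (\<pi> ?u) ?x)" by simp
    also have "\<dots> = (\<Sum>n\<in>N. pscale (c ?u n) (\<pi> (pmult n ?x)))"
      using N(2) unfolding u
      by (subst pmult_sum_left, subst \<pi>_sum) (auto simp: pmult_scale intro!: free sum.cong \<pi>_scale)
    finally have "\<pi> (pword (take (Suc k) w)) = (\<Sum>n\<in>N. pscale (c ?u n) (\<pi> (pmult n ?x)))" .
    moreover have "pmult (\<pi> ?u) ?x = (\<Sum>n\<in>N. pscale (c ?u n) (pmult n ?x))"
      by (simp only: u pmult_sum_left pmult_scale)
    ultimately show ?thesis
      by (simp only: b_def ncpoly.scale_right_diff_distrib sum_subtractf)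
  qed

  have word: "pword w = \<pi> (pword w) + pmult (pword [] - \<pi> (pword [])) (pword w)
      + (\<Sum>n\<in>N. \<Sum>x\<in>X. pmult (b n x) (\<Sum>k<length w.
          pscale (if w ! k = x then c (pword (take k w)) n else 0) (pword (drop (Suc k) w))))"
    if w: "w \<in> ?W" for w
  proof -
    \<comment> \<open>\<open>t k\<close> projects the first \<open>k\<close> letters and leaves the
      rest alone. Multiplying \<open>step\<close> by the remaining suffix gives
      \<open>t k - t (Suc k)\<close>, and the telescope runs from \<open>\<pi> 1\<close> times
      \<open>w\<close> down to \<open>\<pi> w\<close>.\<close>
    define t where "t k = pmult (\<pi> (pword (take k w))) (pword (drop k w))" for k
    have "(\<Sum>n\<in>N. \<Sum>x\<in>X. pmult (b n x) (\<Sum>k<length w.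
          pscale (if w ! k = x then c (pword (take k w)) n else 0) (pword (drop (Suc k) w))))
      = (\<Sum>n\<in>N. \<Sum>k<length w. \<Sum>x\<in>X.
          if w ! k = x then pscale (c (pword (take k w)) n) (pmult (b n x) (pword (drop (Suc k) w))) else 0)"
      by (intro sum.cong refl)
        (subst sum.swap, auto simp: pmult_sum_right pmult_scale intro!: sum.cong)
    also have "\<dots> = (\<Sum>n\<in>N. \<Sum>k<length w.
          pscale (c (pword (take k w)) n) (pmult (b n (w ! k)) (pword (drop (Suc k) w))))"
      using w X by (intro sum.cong refl) (subst sum.delta', auto simp: X_def)
    also have "\<dots> = (\<Sum>k<length w. pmult (\<Sum>n\<in>N. pscale (c (pword (take k w)) n) (b n (w ! k))) (pword (drop (Suc k) w)))"
      by (subst sum.swap) (simp add: pmult_sum_left pmult_scale)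
    also have "\<dots> = (\<Sum>k<length w. t k - t (Suc k))"
    proof (intro sum.cong refl)
      fix k assume "k \<in> {..<length w}"
      then have k: "k < length w" by simp
      show "pmult (\<Sum>n\<in>N. pscale (c (pword (take k w)) n) (b n (w ! k))) (pword (drop (Suc k) w)) = t k - t (Suc k)"
        unfolding step[OF w k, symmetric] t_def
        by (simp add: pmult_diff_left pmult_pword_assoc \<pi>_free Cons_nth_drop_Suc[OF k])
    qed
    also have "\<dots> = t 0 - t (length w)" by (rule sum_lessThan_telescope')
    also have "\<dots> = pmult (\<pi> (pword [])) (pword w) - \<pi> (pword w)"
      by (simp add: t_def pmult_Nil_right \<pi>_free)
    finally show ?thesis
      by (simp add: pmult_diff_left pmult_pword)
  qed

  have "f = (\<Sum>w\<in>?W. pscale (f w) (pword w))" by (rule ncpoly_eq_sum_pword[OF f])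
  also have "\<dots> = (\<Sum>w\<in>?W. pscale (f w) (\<pi> (pword w)))
      + (\<Sum>w\<in>?W. pscale (f w) (pmult (pword [] - \<pi> (pword [])) (pword w)))
      + (\<Sum>w\<in>?W. pscale (f w) (\<Sum>n\<in>N. \<Sum>x\<in>X. pmult (b n x) (\<Sum>k<length w.
          pscale (if w ! k = x then c (pword (take k w)) n else 0) (pword (drop (Suc k) w)))))"
    unfolding sum.distrib[symmetric] ncpoly.scale_right_distrib[symmetric]
    by (intro sum.cong refl arg_cong2[where f = pscale] word)
  also have "(\<Sum>w\<in>?W. pscale (f w) (\<pi> (pword w))) = \<pi> f"
    by (subst (3) ncpoly_eq_sum_pword[OF f]) (simp add: \<pi>_sum \<pi>_scale free)
  also have "\<pi> f = 0" by (rule \<pi>_0[OF fI])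
  also have "(\<Sum>w\<in>?W. pscale (f w) (pmult (pword [] - \<pi> (pword [])) (pword w))) = pmult (pword [] - \<pi> (pword [])) f"
    by (subst (3) ncpoly_eq_sum_pword[OF f]) (simp add: pmult_sum_right pmult_scale)
  also have "(\<Sum>w\<in>?W. pscale (f w) (\<Sum>n\<in>N. \<Sum>x\<in>X. pmult (b n x) (\<Sum>k<length w.
          pscale (if w ! k = x then c (pword (take k w)) n else 0) (pword (drop (Suc k) w)))))
      = (\<Sum>n\<in>N. \<Sum>x\<in>X. pmult (b n x) (G n x))"
    (is "(\<Sum>w\<in>?W. pscale (f w) (\<Sum>n\<in>N. \<Sum>x\<in>X. pmult (b n x) (?H w n x))) = _")
  proof -
    have "(\<Sum>n\<in>N. \<Sum>x\<in>X. pmult (b n x) (G n x))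
        = (\<Sum>n\<in>N. \<Sum>x\<in>X. \<Sum>w\<in>?W. pscale (f w) (pmult (b n x) (?H w n x)))"
      unfolding G_def by (simp only: pmult_sum_right[of _ _ ?W] pmult_scale)
    also have "\<dots> = (\<Sum>n\<in>N. \<Sum>w\<in>?W. \<Sum>x\<in>X. pscale (f w) (pmult (b n x) (?H w n x)))"
      by (intro sum.cong refl sum.swap)
    also have "\<dots> = (\<Sum>w\<in>?W. \<Sum>n\<in>N. \<Sum>x\<in>X. pscale (f w) (pmult (b n x) (?H w n x)))"
      by (rule sum.swap)
    finally show ?thesis by (simp only: ncpoly.scale_sum_right)
  qed
  \<comment> \<open>Summed over the words of \<open>f\<close>, the projected part is
    \<open>\<pi> f\<close>, which vanishes because \<open>f\<close> lies in \<open>I\<close>. The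
    first remaining term is in the product because \<open>f\<close> is also in \<open>J\<close>, the
    double sum because each \<open>G n x\<close> is.\<close>
  finally have f_eq: "f = pmult (pword [] - \<pi> (pword [])) f + (\<Sum>n\<in>N. \<Sum>x\<in>X. pmult (b n x) (G n x))"
    unfolding add_0 .
  have "pmult (pword [] - \<pi> (pword [])) f \<in> iprod I J"
    by (intro iprod_mult \<pi>_diff free fJ)
  moreover have "(\<Sum>n\<in>N. \<Sum>x\<in>X. pmult (b n x) (G n x)) \<in> iprod I J"
    using N by (intro iprod_sum iprod_mult bI GJ) auto
  ultimately have "pmult (pword [] - \<pi> (pword [])) f + (\<Sum>n\<in>N. \<Sum>x\<in>X. pmult (b n x) (G n x)) \<in> iprod I J"
    by (rule iprod_plus)
  then show ?thesis unfolding f_eq[symmetric] .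
qed

subsection \<open>The Grassmann algebra\<close>

lemma gsign_ne_0: "gsign S T \<noteq> (0 :: 'a::field)"
  by (simp add: gsign_def)

text \<open>An inversion starts either in \<open>A\<close> or in \<open>B\<close>, and disjointness
  makes the two counts add. With the mirror image below, signs become bimultiplicative, which is
  what associativity rests on.\<close>

lemma gsign_Un_left:
  assumes "finite A" "finite B" "finite C" "A \<inter> B = {}"
  shows "gsign (A \<union> B) C = (gsign A C * gsign B C :: 'a::field)"
proof -
  have "{(s, t). s \<in> A \<union> B \<and> t \<in> C \<and> t < s}
      = {(s, t). s \<in> A \<and> t \<in> C \<and> t < s} \<union> {(s, t). s \<in> B \<and> t \<in> C \<and> t < s}" by auto
  moreover have "finite {(s, t). s \<in> A \<and> t \<in> C \<and> t < s}" "finite {(s, t). s \<in> B \<and> t \<in> C \<and> t < s}"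
    by (rule finite_subset[of _ "A \<times> C"] finite_subset[of _ "B \<times> C"]; use assms in auto)+
  ultimately show ?thesis
    using assms(4) unfolding gsign_def by (subst power_add[symmetric], subst card_Un_disjoint[symmetric]) auto
qed

lemma gsign_Un_right:
  assumes "finite A" "finite B" "finite C" "B \<inter> C = {}"
  shows "gsign A (B \<union> C) = (gsign A B * gsign A C :: 'a::field)"
proof -
  have "{(s, t). s \<in> A \<and> t \<in> B \<union> C \<and> t < s}
      = {(s, t). s \<in> A \<and> t \<in> B \<and> t < s} \<union> {(s, t). s \<in> A \<and> t \<in> C \<and> t < s}" by auto
  moreover have "finite {(s, t). s \<in> A \<and> t \<in> B \<and> t < s}" "finite {(s, t). s \<in> A \<and> t \<in> C \<and> t < s}"
    by (rule finite_subset[of _ "A \<times> B"] finite_subset[of _ "A \<times> C"]; use assms in auto)+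
  ultimately show ?thesis
    using assms(4) unfolding gsign_def by (subst power_add[symmetric], subst card_Un_disjoint[symmetric]) auto
qed

text \<open>Both sides run over ordered partitions of \<open>U\<close> into three parts, here
  \<open>T\<close>, \<open>S - T\<close>, \<open>U - S\<close>. By bimultiplicativity either
  bracketing gives the product of the three pairwise signs.\<close>

lemma gmult_assoc: "gmult (gmult x y) z = gmult x (gmult y z)"
proof
  fix U :: "nat set"
  show "gmult (gmult x y) z U = gmult x (gmult y z) U"
  proof (cases "finite U")
    case True
    have fin: "finite S" if "S \<subseteq> U" for S using that True by (rule finite_subset)
    have "gmult (gmult x y) z U = (\<Sum>S\<in>Pow U. \<Sum>T\<in>Pow S.
        gsign S (U - S) * gsign T (S - T) * x T * y (S - T) * z (U - S))"
      using True fin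
      by (auto simp: gmult_def sum_distrib_left sum_distrib_right mult.assoc intro!: sum.cong)
    also have "\<dots> = (\<Sum>(S, T)\<in>Sigma (Pow U) Pow.
        gsign S (U - S) * gsign T (S - T) * x T * y (S - T) * z (U - S))"
      using True fin by (intro sum.Sigma) auto
    also have "\<dots> = (\<Sum>(T, R)\<in>Sigma (Pow U) (\<lambda>T. Pow (U - T)).
        gsign T (U - T) * gsign R (U - T - R) * x T * y R * z (U - T - R))"
    proof (rule sum.reindex_bij_witness[where i = "\<lambda>(T, R). (T \<union> R, T)" and j = "\<lambda>(S, T). (T, S - T)"], goal_cases)
      case (5 a)
      then obtain S T where a: "a = (S, T)" "S \<subseteq> U" "T \<subseteq> S" by auto
      have eq: "S = T \<union> (S - T)" "U - T = (S - T) \<union> (U - S)" "U - T - (S - T) = U - S" using a by auto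
      have "finite T" "finite (S - T)" "finite (U - S)" using a fin by auto
      then have "gsign (T \<union> (S - T)) (U - S) * gsign T (S - T)
          = (gsign T ((S - T) \<union> (U - S)) * gsign (S - T) (U - S) :: 'a)"
        using a(2,3) by (subst gsign_Un_left; (subst gsign_Un_right)?) auto
      then show ?case using eq by (auto simp: a(1))
    qed auto
    also have "\<dots> = (\<Sum>T\<in>Pow U. \<Sum>R\<in>Pow (U - T).
        gsign T (U - T) * gsign R (U - T - R) * x T * y R * z (U - T - R))"
      using True fin by (intro sum.Sigma[symmetric]) auto
    also have "\<dots> = gmult x (gmult y z) U"
      using True fin
      by (auto simp: gmult_def sum_distrib_left sum_distrib_right mult_ac intro!: sum.cong)
    finally show ?thesis .
  qed (simp add: gmult_def)
qed

lemma gmult_sum_left: "gmult (\<lambda>S. \<Sum>k\<in>K. f k S) y = (\<lambda>U. \<Sum>k\<in>K. gmult (f k) y U)"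
  by (auto simp: gmult_def fun_eq_iff sum_distrib_left sum_distrib_right intro: sum.swap)

lemma gmult_sum_right: "gmult y (\<lambda>S. \<Sum>k\<in>K. f k S) = (\<lambda>U. \<Sum>k\<in>K. gmult y (f k) U)"
  by (auto simp: gmult_def fun_eq_iff sum_distrib_left intro: sum.swap)

lemma gmult_gzero [simp]: "gmult gzero x = gzero" "gmult x gzero = gzero"
  by (auto simp: gmult_def gzero_def fun_eq_iff)

text \<open>\<open>gmult\<close> returns 0 at infinite index sets by default, so the unit law
  requires that \<open>x\<close> vanish there.\<close>

lemma gmult_gone_left:
  assumes "\<And>S. infinite S \<Longrightarrow> x S = 0"
  shows "gmult gone x = x"
proof
  fix U
  show "gmult gone x U = x U"
  proof (cases "finite U")
    case True
    then have "gmult gone x U = (\<Sum>S\<in>Pow U. if S = {} then x U else 0)"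
      unfolding gmult_def by (simp only: if_True, intro sum.cong) (auto simp: gone_def gsign_def)
    then show ?thesis using True by simp
  qed (simp add: gmult_def assms)
qed

text \<open>Of all splittings of \<open>S \<union> T\<close>, only the one whose left part is in
  \<open>P\<close> and right part in \<open>Q\<close> survives. Coordinates of the two factors can
  thus be read off a product.\<close>

lemma gmult_disjoint_support:
  assumes "finite S" "finite T" "S \<subseteq> P" "T \<subseteq> Q" "P \<inter> Q = {}"
    and "\<And>A. x A \<noteq> 0 \<Longrightarrow> A \<subseteq> P" "\<And>A. y A \<noteq> 0 \<Longrightarrow> A \<subseteq> Q"
  shows "gmult x y (S \<union> T) = gsign S T * x S * y T"
proof -
  have "gmult x y (S \<union> T) = (\<Sum>A\<in>Pow (S \<union> T). if A = S then gsign S T * x S * y T else 0)"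
    unfolding gmult_def
  proof (simp only: finite_Un assms if_True simp_thms, intro sum.cong refl)
    fix A assume A: "A \<in> Pow (S \<union> T)"
    have "A = S" if "x A \<noteq> 0" "y (S \<union> T - A) \<noteq> 0"
      using assms(6)[OF that(1)] assms(7)[OF that(2)] A assms(3-5) by blast
    moreover have "S \<union> T - S = T" using assms(3-5) by blast
    ultimately show "gsign A (S \<union> T - A) * x A * y (S \<union> T - A) = (if A = S then gsign S T * x S * y T else 0)"
      by auto
  qed
  then show ?thesis using assms(1,2) by simp
qed

lemma gmult_support:
  assumes "\<And>A. x A \<noteq> 0 \<Longrightarrow> A \<subseteq> P" "\<And>A. y A \<noteq> 0 \<Longrightarrow> A \<subseteq> Q" "gmult x y A \<noteq> 0"
  shows "A \<subseteq> P \<union> Q"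
proof -
  have "\<exists>S\<in>Pow A. gsign S (A - S) * x S * y (A - S) \<noteq> 0"
    using assms(3) unfolding gmult_def by (metis (no_types, lifting) sum.neutral)
  then obtain S where "x S \<noteq> 0" "y (A - S) \<noteq> 0" by auto
  then show ?thesis using assms(1,2) by blast
qed

text \<open>For strictly monotone \<open>h\<close> this is the algebra endomorphism with \<open>e\<^sub>i \<mapsto> e\<^sub>h\<^sub>(\<^sub>i\<^sub>)\<close>.\<close>

definition gpush :: "(nat \<Rightarrow> nat) \<Rightarrow> ('a::field) grass \<Rightarrow> 'a grass" where
  "gpush h x = (\<lambda>S. if S \<subseteq> range h then x (h -` S) else 0)"

lemma gpush_image: "inj h \<Longrightarrow> gpush h x (h ` S) = x S"
  by (auto simp: gpush_def inj_vimage_image_eq)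

text \<open>A strictly monotone map carries inversions bijectively to inversions.\<close>

lemma gsign_image:
  assumes "strict_mono h"
  shows "gsign (h ` S) (h ` T) = (gsign S T :: 'a::field)"
proof -
  have h: "h s < h t \<longleftrightarrow> s < t" for s t using assms by (simp add: strict_mono_less)
  have "{(s, t). s \<in> h ` S \<and> t \<in> h ` T \<and> t < s} = map_prod h h ` {(s, t). s \<in> S \<and> t \<in> T \<and> t < s}"
    using h by (auto simp: image_iff)
  moreover have "inj (map_prod h h)"
    using assms by (simp add: prod.inj_map strict_mono_imp_inj_on)
  ultimately show ?thesis
    unfolding gsign_def by (simp add: card_image inj_on_subset)
qed

text \<open>Inside the range of \<open>h\<close>, splittings and signs correspond to those of the
  preimage. If \<open>U\<close> leaves the range, one part of each splitting does too, so both sides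
  vanish; at infinite \<open>U\<close> both take the default 0.\<close>

lemma gpush_gmult:
  assumes h: "strict_mono h"
  shows "gmult (gpush h x) (gpush h y) = gpush h (gmult x y)"
proof
  fix U
  have inj: "inj h" using h by (rule strict_mono_imp_inj_on)
  consider "infinite U" | "finite U" "\<not> U \<subseteq> range h" | "finite U" "U \<subseteq> range h" by blast
  then show "gmult (gpush h x) (gpush h y) U = gpush h (gmult x y) U"
  proof cases
    case 1
    then have "infinite (h -` U)" if "U \<subseteq> range h"
      using that by (metis finite_imageI image_vimage_eq inf.absorb1)
    then show ?thesis using 1 by (auto simp: gmult_def gpush_def)
  next
    case 2
    then have "gpush h x S = 0 \<or> gpush h y (U - S) = 0" if "S \<subseteq> U" for S
      using that by (auto simp: gpush_def)
    then have "gmult (gpush h x) (gpush h y) U = 0"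
      unfolding gmult_def by (auto intro!: sum.neutral)
    then show ?thesis using 2 by (simp add: gpush_def)
  next
    case 3
    then obtain V where U: "U = h ` V" by (metis subset_imageE)
    have V: "finite V" using 3 U inj by (metis finite_imageD inj_on_subset subset_UNIV)
    have "gmult (gpush h x) (gpush h y) U
        = (\<Sum>S\<in>(`) h ` Pow V. gsign S (U - S) * gpush h x S * gpush h y (U - S))"
      using 3 by (simp add: gmult_def U image_Pow_surj[of h V])
    also have "\<dots> = (\<Sum>S\<in>Pow V. gsign (h ` S) (U - h ` S) * gpush h x (h ` S) * gpush h y (U - h ` S))"
      using inj by (subst sum.reindex) (auto intro!: inj_onI simp: inj_image_eq_iff)
    also have "\<dots> = (\<Sum>S\<in>Pow V. gsign S (V - S) * x S * y (V - S))"
      by (intro sum.cong refl)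
        (simp add: U image_set_diff[OF inj, symmetric] gsign_image[OF h] gpush_image[OF inj])
    also have "\<dots> = gpush h (gmult x y) U"
      using V by (simp add: U gpush_image[OF inj] gmult_def)
    finally show ?thesis .
  qed
qed

lemma gpush_gone: "gpush h gone = gone"
  by (auto simp: gpush_def gone_def fun_eq_iff) blast

lemma gpush_gzero: "gpush h gzero = gzero"
  by (auto simp: gpush_def gzero_def fun_eq_iff)

lemma gpush_sum: "gpush h (\<lambda>S. \<Sum>k\<in>K. f k S) = (\<lambda>S. \<Sum>k\<in>K. gpush h (f k) S)"
  by (auto simp: gpush_def fun_eq_iff)

lemma gpush_support: "gpush h x S \<noteq> 0 \<Longrightarrow> S \<subseteq> range h"
  by (auto simp: gpush_def split: if_splits)

text \<open>The degree counts odd indices, so it survives when \<open>h\<close> preserves parity;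
  the condition at 0 keeps the inadmissible index 0 out of the new supports.\<close>

lemma gpush_grass_deg:
  assumes h: "strict_mono h" "\<And>i. odd (h i) \<longleftrightarrow> odd i" "\<And>i. h i = 0 \<Longrightarrow> i = 0"
    and x: "x \<in> grass_deg b"
  shows "gpush h x \<in> grass_deg b"
proof -
  have inj: "inj h" using h(1) by (rule strict_mono_imp_inj_on)
  have ex: "\<exists>T. S = h ` T \<and> x T \<noteq> 0" if "gpush h x S \<noteq> 0" for S
  proof -
    have S: "S \<subseteq> range h" using that by (rule gpush_support)
    then obtain T where "S = h ` T" by (metis subset_imageE)
    then show ?thesis using that gpush_image[OF inj] by metis
  qed
  have "{S. gpush h x S \<noteq> 0} \<subseteq> (`) h ` {T. x T \<noteq> 0}" using ex by blast
  then have "finite {S. gpush h x S \<noteq> 0}"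
    using x by (auto simp: grass_deg_def grass_carrier_def intro: finite_subset)
  moreover have "finite S \<and> 0 \<notin> S \<and> odd (card {i \<in> S. odd i}) = b" if S: "gpush h x S \<noteq> 0" for S
  proof -
    obtain T where T: "S = h ` T" "x T \<noteq> 0" using ex[OF S] by blast
    have "{i \<in> S. odd i} = h ` {i \<in> T. odd i}" using h(2) T by auto
    then have "card {i \<in> S. odd i} = card {i \<in> T. odd i}"
      using inj by (simp add: card_image inj_on_subset)
    moreover have "finite T" "0 \<notin> T" "odd (card {i \<in> T. odd i}) = b"
      using x T(2) by (auto simp: grass_deg_def grass_carrier_def)
    ultimately show ?thesis using T h(3) by (metis finite_imageI imageE)
  qed
  ultimately show ?thesis by (auto simp: grass_deg_def grass_carrier_def)
qed

subsection \<open>Matrices over the Grassmann algebra\<close>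

lemma mmult_assoc: "mmult n (mmult n A B) C = mmult n A (mmult n B C)"
proof (intro ext)
  fix i j S
  show "mmult n (mmult n A B) C i j S = mmult n A (mmult n B C) i j S"
  proof (cases "i < n \<and> j < n")
    case True
    have *: "mmult n A B i k = (\<lambda>S. \<Sum>l<n. gmult (A i l) (B l k) S)"
      "mmult n B C k j = (\<lambda>S. \<Sum>l<n. gmult (B k l) (C l j) S)" if "k < n" for k
      using that True by (auto simp: mmult_def)
    have "mmult n (mmult n A B) C i j S = (\<Sum>k<n. \<Sum>l<n. gmult (gmult (A i l) (B l k)) (C k j) S)"
      using True by (simp add: mmult_def[of n "mmult n A B"] * gmult_sum_left)
    also have "\<dots> = (\<Sum>l<n. \<Sum>k<n. gmult (A i l) (gmult (B l k) (C k j)) S)"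
      by (subst sum.swap) (simp add: gmult_assoc)
    also have "\<dots> = mmult n A (mmult n B C) i j S"
      using True by (simp add: mmult_def[of n A] * gmult_sum_right)
    finally show ?thesis .
  qed (auto simp: mmult_def)
qed

lemma mword_Nil [simp]: "mword n \<phi> [] = mone n"
  by (simp add: mword_def)

lemma mword_Cons [simp]: "mword n \<phi> (x # w) = mmult n (\<phi> x) (mword n \<phi> w)"
  by (simp add: mword_def)

lemma mword_infinite: "infinite S \<Longrightarrow> mword n \<phi> w i j S = 0"
  by (cases w) (auto simp: mone_def gone_def gzero_def mmult_def gmult_def)

lemma mword_outside: "i \<ge> n \<or> j \<ge> n \<Longrightarrow> mword n \<phi> w i j = gzero"
  by (cases w) (auto simp: mone_def gzero_def mmult_def)

lemma mone_mmult_mword: "mmult n (mone n) (mword n \<phi> w) = mword n \<phi> w"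
proof (intro ext)
  fix i j S
  show "mmult n (mone n) (mword n \<phi> w) i j S = mword n \<phi> w i j S"
  proof (cases "i < n \<and> j < n")
    case True
    then have "mmult n (mone n) (mword n \<phi> w) i j S = (\<Sum>k<n. if i = k then mword n \<phi> w k j S else 0)"
      unfolding mmult_def by (simp only: simp_thms if_True, intro sum.cong refl)
        (auto simp: mone_def gmult_gone_left mword_infinite gzero_def[THEN fun_cong])
    then show ?thesis using True by simp
  next
    case False
    then have "mword n \<phi> w i j = gzero" by (intro mword_outside) auto
    then show ?thesis using False by (auto simp: mmult_def gzero_def)
  qed
qed

lemma mword_append: "mword n \<phi> (u @ v) = mmult n (mword n \<phi> u) (mword n \<phi> v)"
  by (induction u) (simp_all add: mone_mmult_mword mmult_assoc)

text \<open>Products of size \<open>n\<close> read only entries with indices below \<open>n\<close>,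
  so a larger block matrix may stand in for its leading block.\<close>

lemma mword_cong:
  assumes "\<And>x i j. i < n \<Longrightarrow> j < n \<Longrightarrow> \<phi> x i j = \<psi> x i j"
  shows "mword n \<phi> w = mword n \<psi> w"
  by (induction w) (auto simp: mmult_def assms intro!: ext sum.cong)

lemma mword_gpush:
  assumes "strict_mono h"
  shows "mword n (\<lambda>x i j. gpush h (\<phi> x i j)) w i j = gpush h (mword n \<phi> w i j)"
proof (induction w arbitrary: i j)
  case Nil
  then show ?case by (simp add: mone_def gpush_gone gpush_gzero)
next
  case (Cons x w)
  show ?case
  proof (cases "i < n \<and> j < n")
    case True
    then have "mword n \<phi> (x # w) i j = (\<lambda>S. \<Sum>k<n. gmult (\<phi> x i k) (mword n \<phi> w k j) S)"
      by (auto simp: mmult_def)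
    then show ?thesis
      using True by (simp only: gpush_sum) (auto simp: mmult_def Cons gpush_gmult[OF assms])
  next
    case False
    then show ?thesis by (subst (1 2) mword_outside) (auto simp: gpush_gzero)
  qed
qed

lemma peval_eq_pairing: "peval n \<phi> f i j S = pairing (\<lambda>w. mword n \<phi> w i j S) f"
  by (simp add: peval_def pairing_def)

lemma peval_outside: "i \<ge> n \<or> j \<ge> n \<Longrightarrow> peval n \<phi> f i j = gzero"
  by (auto simp: peval_def mword_outside gzero_def fun_eq_iff)

lemma peval_pmult:
  assumes "f \<in> free_alg" "g \<in> free_alg"
  shows "peval n \<phi> (pmult f g) = mmult n (peval n \<phi> f) (peval n \<phi> g)"
proof (intro ext)
  fix i j S
  let ?F = "{w. f w \<noteq> 0}" and ?G = "{w. g w \<noteq> 0}"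
  show "peval n \<phi> (pmult f g) i j S = mmult n (peval n \<phi> f) (peval n \<phi> g) i j S"
  proof (cases "i < n \<and> j < n")
    case True
    have scale: "gmult (\<lambda>S. a * x S) (\<lambda>S. b * y S) T = a * b * gmult x y T" for a b :: 'a and x y T
      by (simp add: gmult_def sum_distrib_left mult_ac)
    have "peval n \<phi> (pmult f g) i j S
        = (\<Sum>u\<in>?F. \<Sum>v\<in>?G. \<Sum>k<n. f u * g v * gmult (mword n \<phi> u i k) (mword n \<phi> v k j) S)"
      using True unfolding peval_eq_pairing pairing_pmult[OF assms]
      by (simp add: mword_append mmult_def sum_distrib_left)
    also have "\<dots> = (\<Sum>u\<in>?F. \<Sum>k<n. \<Sum>v\<in>?G. f u * g v * gmult (mword n \<phi> u i k) (mword n \<phi> v k j) S)"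
      by (intro sum.cong refl sum.swap)
    also have "\<dots> = (\<Sum>k<n. \<Sum>u\<in>?F. \<Sum>v\<in>?G. f u * g v * gmult (mword n \<phi> u i k) (mword n \<phi> v k j) S)"
      by (rule sum.swap)
    also have "\<dots> = mmult n (peval n \<phi> f) (peval n \<phi> g) i j S"
      using True by (simp add: mmult_def peval_def gmult_sum_left gmult_sum_right scale)
    finally show ?thesis .
  next
    case False
    then show ?thesis by (auto simp: mmult_def peval_outside gzero_def)
  qed
qed

lemma sum_lessThan_add:
  fixes f :: "nat \<Rightarrow> 'a::comm_monoid_add"
  shows "(\<Sum>k<m + n. f k) = (\<Sum>k<m. f k) + (\<Sum>k<n. f (k + m))"
  by (induction n) (simp_all add: add_ac)

subsection \<open>Block triangular matrices\<close>

text \<open>A path of indices through the factors can never return from the tail block to the head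
  block. A path that starts and ends in one diagonal block therefore stays in it.\<close>

lemma mword_block:
  fixes \<Phi> :: "nat + nat \<Rightarrow> ('a::field) gmat"
  assumes lower: "\<And>x i j. d \<le> i \<Longrightarrow> i < d + n \<Longrightarrow> j < d \<Longrightarrow> \<Phi> x i j = gzero"
  shows "i < d \<Longrightarrow> j < d \<Longrightarrow> mword (d + n) \<Phi> w i j = mword d \<Phi> w i j" (is "_ \<Longrightarrow> _ \<Longrightarrow> ?A")
    and "d \<le> i \<Longrightarrow> j < d \<Longrightarrow> mword (d + n) \<Phi> w i j = gzero" (is "_ \<Longrightarrow> _ \<Longrightarrow> ?B")
    and "i < n \<Longrightarrow> j < n \<Longrightarrow>
      mword (d + n) \<Phi> w (i + d) (j + d) = mword n (\<lambda>x i j. \<Phi> x (i + d) (j + d)) w i j" (is "_ \<Longrightarrow> _ \<Longrightarrow> ?C")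
proof -
  have lower0: "mword (d + n) \<Phi> w i j = gzero" if "d \<le> i" "j < d" for w i j
    using that
  proof (induction w arbitrary: i)
    case (Cons x w)
    show ?case
    proof (cases "i < d + n")
      case True
      then have "gmult (\<Phi> x i k) (mword (d + n) \<Phi> w k j) = gzero" if "k < d + n" for k
        using Cons lower that by (cases "k < d") auto
      then show ?thesis by (auto simp: mmult_def gzero_def fun_eq_iff)
    qed (simp add: mword_outside del: mword_Cons)
  qed (auto simp: mone_def)
  then show "d \<le> i \<Longrightarrow> j < d \<Longrightarrow> ?B" .
  show "i < d \<Longrightarrow> j < d \<Longrightarrow> ?A"
  proof (induction w arbitrary: i)
    case (Cons x w)
    then show ?case
      by (auto simp: mmult_def sum_lessThan_add lower0 gzero_def[THEN fun_cong] intro!: ext)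
  qed (auto simp: mone_def)
  show "i < n \<Longrightarrow> j < n \<Longrightarrow> ?C"
  proof (induction w arbitrary: i)
    case (Cons x w)
    then show ?case
      by (auto simp: mmult_def sum_lessThan_add lower gzero_def[THEN fun_cong] intro!: ext)
  qed (auto simp: mone_def)
qed

lemma peval_block:
  assumes "\<And>x i j. d \<le> i \<Longrightarrow> i < d + n \<Longrightarrow> j < d \<Longrightarrow> \<Phi> x i j = gzero"
  shows "i < d \<Longrightarrow> j < d \<Longrightarrow> peval (d + n) \<Phi> f i j = peval d \<Phi> f i j"
    and "d \<le> i \<Longrightarrow> j < d \<Longrightarrow> peval (d + n) \<Phi> f i j = gzero"
    and "i < n \<Longrightarrow> j < n \<Longrightarrow>
      peval (d + n) \<Phi> f (i + d) (j + d) = peval n (\<lambda>x i j. \<Phi> x (i + d) (j + d)) f i j"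
  using mword_block[of d n \<Phi>, OF assms] by (auto simp: peval_def gzero_def fun_eq_iff)

text \<open>A path from the head to the tail crosses the corner exactly once. The crossing is
  possible only at a letter \<open>x\<close> and only from row \<open>p\<close> to column
  \<open>q\<close>, so the word is cut into a prefix evaluated in the head and a suffix evaluated in
  the tail.\<close>

lemma mword_block_corner:
  fixes \<Phi> :: "nat + nat \<Rightarrow> ('a::field) gmat"
  assumes lower: "\<And>x i j. d \<le> i \<Longrightarrow> i < d + n \<Longrightarrow> j < d \<Longrightarrow> \<Phi> x i j = gzero"
    and corner: "\<And>y i j. i < d \<Longrightarrow> j < n \<Longrightarrow> \<Phi> y i (j + d) = (if y = x \<and> i = p \<and> j = q then \<epsilon> else gzero)"
    and \<epsilon>: "\<And>S. infinite S \<Longrightarrow> \<epsilon> S = 0" and "p < d" "q < n" "i < d" "j < n"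
  shows "mword (d + n) \<Phi> w i (j + d) S = (\<Sum>k<length w. if w ! k = x
      then gmult (gmult (mword d \<Phi> (take k w) i p) \<epsilon>)
        (mword n (\<lambda>x i j. \<Phi> x (i + d) (j + d)) (drop (Suc k) w) q j) S else 0)"
  using \<open>i < d\<close>
proof (induction w arbitrary: i S)
  case Nil
  then show ?case by (simp add: mone_def gzero_def)
next
  case (Cons y w)
  let ?\<psi> = "\<lambda>x i j. \<Phi> x (i + d) (j + d)"
  let ?R = "\<lambda>k. mword n ?\<psi> (drop (Suc k) w) q j"
  have "mword (d + n) \<Phi> (y # w) i (j + d) S
      = (\<Sum>l<d. gmult (\<Phi> y i l) (mword (d + n) \<Phi> w l (j + d)) S)
      + (\<Sum>l<n. gmult (\<Phi> y i (l + d)) (mword (d + n) \<Phi> w (l + d) (j + d)) S)"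
    using Cons.prems assms by (simp add: mmult_def sum_lessThan_add)
  also have "(\<Sum>l<n. gmult (\<Phi> y i (l + d)) (mword (d + n) \<Phi> w (l + d) (j + d)) S)
      = (\<Sum>l<n. if l = q then (if y = x \<and> i = p then gmult \<epsilon> (mword n ?\<psi> w q j) S else 0) else 0)"
    using Cons.prems \<open>j < n\<close>
    by (intro sum.cong refl) (auto simp: corner mword_block(3)[OF lower] gzero_def[THEN fun_cong])
  \<comment> \<open>The crossing at the first letter has an empty prefix; \<open>mone d i p\<close>
    is the value of that prefix and encodes the condition \<open>i = p\<close>.\<close>
  also have "\<dots> = (if y = x then gmult (gmult (mone d i p) \<epsilon>) (mword n ?\<psi> w q j) S else 0)"
    using \<open>q < n\<close> \<open>p < d\<close> Cons.prems
    by (auto simp: mone_def gmult_gone_left[OF \<epsilon>] gzero_def[THEN fun_cong])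
  also have "(\<Sum>l<d. gmult (\<Phi> y i l) (mword (d + n) \<Phi> w l (j + d)) S)
      = (\<Sum>k<length w. if w ! k = x
          then gmult (gmult (mword d \<Phi> (y # take k w) i p) \<epsilon>) (?R k) S else 0)"
  proof -
    have ind: "mword (d + n) \<Phi> w l (j + d) = (\<lambda>S. \<Sum>k<length w. (if w ! k = x
      then gmult (gmult (mword d \<Phi> (take k w) l p) \<epsilon>) (?R k) else gzero) S)" if "l < d" for l
      using Cons.IH[OF that] by (auto simp: fun_eq_iff gzero_def intro!: sum.cong)
    have "(\<Sum>l<d. gmult (\<Phi> y i l) (mword (d + n) \<Phi> w l (j + d)) S)
        = (\<Sum>l<d. \<Sum>k<length w. if w ! k = x
            then gmult (gmult (gmult (\<Phi> y i l) (mword d \<Phi> (take k w) l p)) \<epsilon>) (?R k) S else 0)"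
      by (intro sum.cong refl)
        (auto simp: ind gmult_sum_right gmult_assoc gzero_def[THEN fun_cong] intro!: sum.cong)
    also have "\<dots> = (\<Sum>k<length w. \<Sum>l<d. if w ! k = x
            then gmult (gmult (gmult (\<Phi> y i l) (mword d \<Phi> (take k w) l p)) \<epsilon>) (?R k) S else 0)"
      by (rule sum.swap)
    also have "\<dots> = (\<Sum>k<length w. if w ! k = x
          then gmult (gmult (mword d \<Phi> (y # take k w) i p) \<epsilon>) (?R k) S else 0)"
    proof (intro sum.cong refl)
      fix k
      have "mword d \<Phi> (y # take k w) i p = (\<lambda>S. \<Sum>l<d. gmult (\<Phi> y i l) (mword d \<Phi> (take k w) l p) S)"
        using Cons.prems \<open>p < d\<close> by (auto simp: mmult_def)
      then show "(\<Sum>l<d. if w ! k = x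
            then gmult (gmult (gmult (\<Phi> y i l) (mword d \<Phi> (take k w) l p)) \<epsilon>) (?R k) S else 0)
          = (if w ! k = x then gmult (gmult (mword d \<Phi> (y # take k w) i p) \<epsilon>) (?R k) S else 0)"
        by (simp only: gmult_sum_left) auto
    qed
    finally show ?thesis .
  qed
  \<comment> \<open>The crossing at the first letter is the term at 0, while a crossing at position
    \<open>k\<close> of \<open>w\<close> is the term at \<open>Suc k\<close>.\<close>
  finally show ?case
    by (auto simp: sum.lessThan_Suc_shift simp del: sum.lessThan_Suc intro!: sum.cong)
qed

section \<open>Block indices and homogeneous block matrices\<close>

text \<open>Past the first block, index 0 fails the \<open>LEAST\<close> condition and all later
  partial sums contain \<open>d\<close>, so the minimum shifts by one. The upper bound on
  \<open>i\<close> guarantees that a minimum exists.\<close>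

lemma blk_Cons:
  shows "i < d \<Longrightarrow> blk (d # ds) i = 0"
    and "d \<le> i \<Longrightarrow> i < d + sum_list ds \<Longrightarrow> blk (d # ds) i = Suc (blk ds (i - d))"
proof -
  show "i < d \<Longrightarrow> blk (d # ds) i = 0" by (simp add: blk_def)
next
  assume i: "d \<le> i" "i < d + sum_list ds"
  have "blk (d # ds) i = Suc (LEAST r. i < sum_list (take (Suc (Suc r)) (d # ds)))"
    unfolding blk_def by (rule Least_Suc[where n = "length ds"]) (use i in auto)
  moreover have "i < sum_list (take (Suc (Suc r)) (d # ds)) \<longleftrightarrow> i - d < sum_list (take (Suc r) ds)" for r
    using i by auto
  ultimately show "blk (d # ds) i = Suc (blk ds (i - d))" by (simp add: blk_def)
qed

lemma gzero_grass_deg: "gzero \<in> grass_deg b"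
  by (simp add: gzero_def grass_deg_def grass_carrier_def)

lemma mdeg_mat_carrier_iff:
  "A \<in> mdeg b (mat_carrier n) \<longleftrightarrow> (\<forall>i j. A i j \<in> grass_deg b) \<and> (\<forall>i j. i \<ge> n \<or> j \<ge> n \<longrightarrow> A i j = gzero)"
  by (auto simp: mdeg_def mat_carrier_def grass_deg_def)

text \<open>Out of range \<open>blk\<close> is an unspecified number while the entries vanish.
  Confining triangularity to indices in range gives a form to which \<open>blk_Cons\<close>
  applies.\<close>

lemma mdeg_UT_iff:
  "A \<in> mdeg b (UT ds) \<longleftrightarrow> A \<in> mdeg b (mat_carrier (sum_list ds)) \<and>
    (\<forall>i j. i < sum_list ds \<longrightarrow> j < sum_list ds \<longrightarrow> blk ds j < blk ds i \<longrightarrow> A i j = gzero)"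
  unfolding mdeg_def UT_def mat_carrier_def by (auto simp: not_less) (metis not_less)

lemma mdeg_UT_lower:
  assumes "A \<in> mdeg b (UT (d # ds))" "d \<le> i" "i < d + sum_list ds" "j < d"
  shows "A i j = gzero"
  using assms by (simp add: mdeg_UT_iff blk_Cons)

lemma mdeg_UT_tail:
  assumes "A \<in> mdeg b (UT (d # ds))"
  shows "(\<lambda>i j. A (i + d) (j + d)) \<in> mdeg b (UT ds)"
  using assms by (auto simp: mdeg_UT_iff mdeg_mat_carrier_iff blk_Cons)

lemma mdeg_UT_head:
  assumes "A \<in> mdeg b (UT (d # ds))"
  shows "(\<lambda>i j. if i < d \<and> j < d then A i j else gzero) \<in> mdeg b (mat_carrier d)"
  using assms by (auto simp: mdeg_UT_iff mdeg_mat_carrier_iff gzero_grass_deg)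

lemma UT_singleton: "mdeg b (UT [d]) = mdeg b (mat_carrier d)"
  by (auto simp: mdeg_UT_iff blk_Cons)

definition block_mat :: "nat \<Rightarrow> ('a::field) gmat \<Rightarrow> 'a gmat \<Rightarrow> 'a gmat \<Rightarrow> 'a gmat" where
  "block_mat d A C B = (\<lambda>i j. if i < d then (if j < d then A i j else C i (j - d))
     else if j < d then gzero else B (i - d) (j - d))"

lemma block_mat_mdeg:
  assumes "A \<in> mdeg b (mat_carrier d)" "B \<in> mdeg b (UT ds)"
    and "\<And>i j. C i j \<in> grass_deg b" "\<And>i j. sum_list ds \<le> j \<Longrightarrow> C i j = gzero"
  shows "block_mat d A C B \<in> mdeg b (UT (d # ds))"
proof -
  have "block_mat d A C B i j = gzero"
    if "i < d + sum_list ds" "j < d + sum_list ds" "blk (d # ds) j < blk (d # ds) i" for i j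
    using that assms(2)
    by (cases "i < d"; cases "j < d") (auto simp: mdeg_UT_iff blk_Cons block_mat_def not_less)
  then show ?thesis
    using assms by (auto simp: mdeg_UT_iff mdeg_mat_carrier_iff block_mat_def gzero_grass_deg)
qed

section \<open>Graded identities as common kernels of functionals\<close>

definition entry_functionals :: "nat \<Rightarrow> ('a::field) gmat set \<Rightarrow> ((nat + nat) list \<Rightarrow> 'a) set" where
  "entry_functionals n R = {\<lambda>w. mword n \<phi> w i j S | \<phi> i j S. graded_subst R \<phi> \<and> i < n \<and> j < n \<and> finite S}"

text \<open>An evaluation vanishes iff all coordinates of its entries do, and each coordinate is a
  \<open>pairing\<close>. Coordinates with an index out of range or an infinite \<open>S\<close> are
  zero on every word, so the restriction to the others loses nothing.\<close>

lemma TZ2_eq_kernel: "TZ2 n R = {f \<in> free_alg. \<forall>\<mu>\<in>entry_functionals n R. pairing \<mu> f = 0}"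
proof -
  have "(peval n \<phi> f = mzero) \<longleftrightarrow> (\<forall>i j S. i < n \<and> j < n \<and> finite S \<longrightarrow> pairing (\<lambda>w. mword n \<phi> w i j S) f = 0)"
    for \<phi> and f :: "'a ncpoly"
  proof -
    have "pairing (\<lambda>w. mword n \<phi> w i j S) f = 0" if "\<not> (i < n \<and> j < n \<and> finite S)" for i j S
      using that mword_outside[of n i j \<phi>] mword_infinite[of S n \<phi>]
      by (auto simp: pairing_def gzero_def)
    then have "(\<forall>i j S. i < n \<and> j < n \<and> finite S \<longrightarrow> pairing (\<lambda>w. mword n \<phi> w i j S) f = 0)
        \<longleftrightarrow> (\<forall>i j S. pairing (\<lambda>w. mword n \<phi> w i j S) f = 0)" by meson
    then show ?thesis
      by (simp add: fun_eq_iff mzero_def gzero_def peval_eq_pairing)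
  qed
  then show ?thesis unfolding TZ2_def entry_functionals_def by (simp only:) blast
qed

lemma TZ2_right_ideal:
  assumes "f \<in> TZ2 n R" "g \<in> free_alg"
  shows "pmult f g \<in> TZ2 n R"
proof -
  have f: "f \<in> free_alg" using assms by (simp add: TZ2_def)
  have "mmult n mzero B = (mzero :: 'a gmat)" for B
    by (auto simp: mmult_def mzero_def gzero_def[THEN fun_cong] fun_eq_iff)
  then show ?thesis
    using assms by (auto simp: TZ2_def peval_pmult[OF f] pmult_free_alg)
qed

text \<open>The generators \<open>e\<^sub>i\<close> with \<open>i\<close> divisible by 3 carry the diagonal block \<open>\<phi>\<close>, those with \<open>i \<equiv> 2\<close> modulo 3
  carry \<open>\<psi>\<close>, and \<open>e\<^sub>1\<close> is the odd entry of the corner; reindexing by \<open>3i\<close> and \<open>3i + 2\<close> preserves parity.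
  As the three families of generators are disjoint, the products of coordinates can be read off
  the evaluation up to a common sign.\<close>

lemma UT_identity_orthogonal:
  fixes f :: "('a::field) ncpoly"
  assumes f: "f \<in> TZ2 (d + sum_list ds) (UT (d # ds))"
    and \<phi>: "graded_subst (mat_carrier d) \<phi>" and \<psi>: "graded_subst (UT ds) \<psi>"
    and idx: "i < d" "p < d" "q < sum_list ds" "j < sum_list ds" and fin: "finite S" "finite T"
  shows "pairing (\<lambda>w. \<Sum>k<length w. if w ! k = x
      then mword d \<phi> (take k w) i p S * mword (sum_list ds) \<psi> (drop (Suc k) w) q j T else 0) f = 0"
proof -
  let ?n = "sum_list ds"
  define g :: "nat \<Rightarrow> nat" where "g = (\<lambda>i. 3 * i)"
  define h :: "nat \<Rightarrow> nat" where "h = (\<lambda>i. 3 * i + 2)"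
  have g: "strict_mono g" "odd (g m) \<longleftrightarrow> odd m" "g m = 0 \<Longrightarrow> m = 0" for m
    by (auto simp: g_def strict_mono_def)
  have h: "strict_mono h" "odd (h m) \<longleftrightarrow> odd m" "h m = 0 \<Longrightarrow> m = 0" for m
    by (auto simp: h_def strict_mono_def)
  have "3 * a \<noteq> 3 * b + (2::nat)" "3 * b + 2 \<noteq> (1::nat)" "3 * b \<noteq> (1::nat)" for a b
    by presburger+
  then have disj: "(range g \<union> {1}) \<inter> range h = {}" "range g \<inter> {1} = {}"
    by (auto simp: g_def h_def)
  \<comment> \<open>The corner entry must have the degree of the letter \<open>x\<close>: the unit
    for an even letter, the odd generator \<open>ggen 1\<close> for an odd one. Either is a single
    basis element, with index set \<open>E\<close>.\<close>
  define \<epsilon> :: "'a grass" where "\<epsilon> = (case x of Inl _ \<Rightarrow> gone | Inr _ \<Rightarrow> ggen 1)"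
  define E :: "nat set" where "E = (case x of Inl _ \<Rightarrow> {} | Inr _ \<Rightarrow> {1})"
  have E: "E \<subseteq> {1}" "finite E" "\<epsilon> E = 1"
    by (auto simp: E_def \<epsilon>_def gone_def ggen_def split: sum.split)
  have \<epsilon>_support: "A \<subseteq> {1}" if "\<epsilon> A \<noteq> 0" for A
    using that by (auto simp: \<epsilon>_def gone_def ggen_def split: sum.splits if_splits)
  have \<epsilon>_inf: "\<epsilon> A = 0" if "infinite A" for A
    using that \<epsilon>_support[of A] finite_subset by fastforce
  have \<epsilon>_deg: "\<epsilon> \<in> grass_deg (\<not> isl x)"
  proof (cases x)
    case Inl
    then show ?thesis by (auto simp: \<epsilon>_def gone_def grass_deg_def grass_carrier_def)
  next
    case Inr
    have "{i \<in> {1::nat}. odd i} = {1}" by auto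
    then show ?thesis using Inr by (auto simp: \<epsilon>_def ggen_def grass_deg_def grass_carrier_def)
  qed

  define C where "C y = (\<lambda>i j. if y = x \<and> i = p \<and> j = q then \<epsilon> else gzero)" for y
  define \<Phi> where "\<Phi> y = block_mat d (\<lambda>i j. gpush g (\<phi> y i j)) (C y) (\<lambda>i j. gpush h (\<psi> y i j))" for y
  have \<Phi>: "\<Phi> y \<in> mdeg b (UT (d # ds))"
    if "\<phi> y \<in> mdeg b (mat_carrier d)" "\<psi> y \<in> mdeg b (UT ds)" "b \<longleftrightarrow> \<not> isl y" for y b
    unfolding \<Phi>_def
  proof (rule block_mat_mdeg)
    show "(\<lambda>i j. gpush g (\<phi> y i j)) \<in> mdeg b (mat_carrier d)"
      using that(1) by (auto simp: mdeg_mat_carrier_iff gpush_gzero intro!: gpush_grass_deg g)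
    show "(\<lambda>i j. gpush h (\<psi> y i j)) \<in> mdeg b (UT ds)"
      using that(2) by (auto simp: mdeg_UT_iff mdeg_mat_carrier_iff gpush_gzero intro!: gpush_grass_deg h)
    show "C y i j \<in> grass_deg b" for i j
      using \<epsilon>_deg that(3) by (simp add: C_def gzero_grass_deg)
    show "C y i j = gzero" if "?n \<le> j" for i j
      using that idx by (auto simp: C_def)
  qed
  have "graded_subst (UT (d # ds)) \<Phi>"
    using \<phi> \<psi> by (auto simp: graded_subst_def intro!: \<Phi>)
  then have "peval (d + ?n) \<Phi> f = mzero" using f by (simp add: TZ2_def)
  then have zero: "pairing (\<lambda>w. mword (d + ?n) \<Phi> w i (j + d) U) f = 0" for U
    by (simp add: mzero_def gzero_def flip: peval_eq_pairing)

  have head: "mword d \<Phi> w i p = gpush g (mword d \<phi> w i p)" for w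
    using mword_cong[of d \<Phi> "\<lambda>y i j. gpush g (\<phi> y i j)"] mword_gpush[OF g(1)]
    by (simp add: \<Phi>_def block_mat_def)
  have tail: "mword ?n (\<lambda>y i j. \<Phi> y (i + d) (j + d)) w q j = gpush h (mword ?n \<psi> w q j)" for w
    using mword_gpush[OF h(1)] by (simp add: \<Phi>_def block_mat_def)
  have corner: "mword (d + ?n) \<Phi> w i (j + d) U = (\<Sum>k<length w. if w ! k = x
      then gmult (gmult (gpush g (mword d \<phi> (take k w) i p)) \<epsilon>) (gpush h (mword ?n \<psi> (drop (Suc k) w) q j)) U
      else 0)" for w U
    unfolding head[symmetric] tail[symmetric]
    by (rule mword_block_corner) (use idx in \<open>auto simp: \<Phi>_def block_mat_def C_def \<epsilon>_inf\<close>)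

  \<comment> \<open>\<open>?U\<close> gathers the generators from the prefix, the corner and the
    suffix. The sign \<open>?c\<close> depends only on \<open>S\<close>, \<open>E\<close> and
    \<open>T\<close>, hence is the same for every word and every crossing; being nonzero, it cancels
    at the end.\<close>
  let ?U = "(g ` S \<union> E) \<union> h ` T"
  let ?c = "gsign (g ` S \<union> E) (h ` T) * gsign (g ` S) E :: 'a"
  have coeff: "gmult (gmult (gpush g a) \<epsilon>) (gpush h b) ?U = ?c * (a S * b T)" for a b :: "'a grass"
  proof -
    have supp: "A \<subseteq> range g \<union> {1}" if "gmult (gpush g a) \<epsilon> A \<noteq> 0" for A
      by (rule gmult_support[OF gpush_support \<epsilon>_support that])
    have "gmult (gmult (gpush g a) \<epsilon>) (gpush h b) ?U
        = gsign (g ` S \<union> E) (h ` T) * gmult (gpush g a) \<epsilon> (g ` S \<union> E) * gpush h b (h ` T)"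
    proof (rule gmult_disjoint_support[where P = "range g \<union> {1}" and Q = "range h"])
      show "g ` S \<union> E \<subseteq> range g \<union> {1}" using E(1) by blast
    qed (use fin E(2) disj(1) in \<open>simp_all only: supp gpush_support image_mono subset_UNIV finite_imageI finite_Un simp_thms\<close>)
    also have "gmult (gpush g a) \<epsilon> (g ` S \<union> E) = gsign (g ` S) E * gpush g a (g ` S) * \<epsilon> E"
    proof (rule gmult_disjoint_support[where P = "range g" and Q = "{1}"])
      show "A \<subseteq> {1}" if "\<epsilon> A \<noteq> 0" for A using that by (rule \<epsilon>_support)
    qed (use fin E(1,2) disj(2) in \<open>simp_all only: gpush_support image_mono subset_UNIV finite_imageI\<close>)
    finally show ?thesis
      using g(1) h(1) E by (simp add: gpush_image strict_mono_imp_inj_on mult_ac)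
  qed
  let ?B = "\<lambda>w. \<Sum>k<length w. if w ! k = x
      then mword d \<phi> (take k w) i p S * mword ?n \<psi> (drop (Suc k) w) q j T else 0"
  have "mword (d + ?n) \<Phi> w i (j + d) ?U = ?c * ?B w" for w
    unfolding corner coeff sum_distrib_left by (intro sum.cong refl) simp
  then have "pairing (\<lambda>w. ?c * ?B w) f = 0"
    using zero[of ?U] by simp
  moreover have "pairing (\<lambda>w. ?c * ?B w) f = ?c * pairing ?B f"
    by (rule pairing_scale_left)
  ultimately show ?thesis using gsign_ne_0[where 'a = 'a] by simp
qed

section \<open>The two inclusions for one split-off block\<close>

lemma zero_mat_mdeg: "(\<lambda>i j. gzero) \<in> mdeg b (mat_carrier n)" "(\<lambda>i j. gzero) \<in> mdeg b (UT ds)"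
  by (auto simp: mdeg_UT_iff mdeg_mat_carrier_iff gzero_grass_deg)

text \<open>A substitution into either diagonal block extends by zeros to a graded substitution into
  the whole algebra, and the evaluation restricts back to that block.\<close>

lemma TZ2_UT_Cons_subset:
  shows "TZ2 (d + sum_list ds) (UT (d # ds)) \<subseteq> (TZ2 d (mat_carrier d) :: ('a::field) ncpoly set)"
    and "TZ2 (d + sum_list ds) (UT (d # ds)) \<subseteq> (TZ2 (sum_list ds) (UT ds) :: 'a ncpoly set)"
proof -
  let ?n = "sum_list ds"
  define \<Phi> :: "(nat + nat \<Rightarrow> 'a gmat) \<Rightarrow> (nat + nat \<Rightarrow> 'a gmat) \<Rightarrow> nat + nat \<Rightarrow> 'a gmat"
    where "\<Phi> \<phi> \<psi> y = block_mat d (\<phi> y) (\<lambda>i j. gzero) (\<psi> y)" for \<phi> \<psi> y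
  have graded: "graded_subst (UT (d # ds)) (\<Phi> \<phi> \<psi>)"
    if "graded_subst (mat_carrier d) \<phi>" "graded_subst (UT ds) \<psi>" for \<phi> \<psi>
    using that by (auto simp: graded_subst_def \<Phi>_def gzero_grass_deg intro!: block_mat_mdeg)
  have zero: "graded_subst (mat_carrier n) (\<lambda>y i j. gzero)" "graded_subst (UT es) (\<lambda>y i j. gzero)" for n es
    by (auto simp: graded_subst_def zero_mat_mdeg)
  have lower: "\<Phi> \<phi> \<psi> y i j = gzero" if "d \<le> i" "j < d" for \<phi> \<psi> y i j
    using that by (simp add: \<Phi>_def block_mat_def)
  show "TZ2 (d + ?n) (UT (d # ds)) \<subseteq> (TZ2 d (mat_carrier d) :: 'a ncpoly set)"
  proof
    fix f :: "'a ncpoly" assume f: "f \<in> TZ2 (d + ?n) (UT (d # ds))"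
    have "peval d \<phi> f i j = gzero" if \<phi>: "graded_subst (mat_carrier d) \<phi>" for \<phi> i j
    proof (cases "i < d \<and> j < d")
      case True
      let ?\<Psi> = "\<Phi> \<phi> (\<lambda>y i j. gzero)"
      have "peval (d + ?n) ?\<Psi> f = mzero"
        using f graded[OF \<phi> zero(2)] by (simp add: TZ2_def)
      moreover have "peval (d + ?n) ?\<Psi> f i j = peval d ?\<Psi> f i j"
        using True by (intro peval_block lower) auto
      moreover have "mword d ?\<Psi> = mword d \<phi>"
        by (intro ext mword_cong[THEN fun_cong, THEN fun_cong, THEN fun_cong])
          (simp add: \<Phi>_def block_mat_def)
      ultimately show ?thesis by (simp add: peval_def mzero_def)
    qed (auto intro!: peval_outside)
    then show "f \<in> TZ2 d (mat_carrier d)"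
      using f by (auto simp: TZ2_def mzero_def fun_eq_iff)
  qed
  show "TZ2 (d + ?n) (UT (d # ds)) \<subseteq> (TZ2 ?n (UT ds) :: 'a ncpoly set)"
  proof
    fix f :: "'a ncpoly" assume f: "f \<in> TZ2 (d + ?n) (UT (d # ds))"
    have "peval ?n \<psi> f i j = gzero" if \<psi>: "graded_subst (UT ds) \<psi>" for \<psi> i j
    proof (cases "i < ?n \<and> j < ?n")
      case True
      let ?\<Psi> = "\<Phi> (\<lambda>y i j. gzero) \<psi>"
      have "peval (d + ?n) ?\<Psi> f = mzero"
        using f graded[OF zero(1) \<psi>] by (simp add: TZ2_def)
      moreover have "peval (d + ?n) ?\<Psi> f (i + d) (j + d) = peval ?n (\<lambda>y i j. ?\<Psi> y (i + d) (j + d)) f i j"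
        using True by (intro peval_block lower) auto
      moreover have "(\<lambda>y i j. ?\<Psi> y (i + d) (j + d)) = \<psi>"
        by (simp add: \<Phi>_def block_mat_def)
      ultimately show ?thesis by (simp add: mzero_def)
    qed (auto intro!: peval_outside)
    then show "f \<in> TZ2 ?n (UT ds)"
      using f by (auto simp: TZ2_def mzero_def fun_eq_iff)
  qed
qed

text \<open>The value of \<open>a\<close> has zero head block and zero lower left block, so its
  first \<open>d\<close> columns vanish; the value of \<open>b\<close> has vanishing rows from
  \<open>d\<close> on. In each entry of the product every summand then has a zero factor.\<close>

lemma pmult_TZ2_UT_Cons:
  fixes a b :: "('a::field) ncpoly"
  assumes a: "a \<in> TZ2 d (mat_carrier d)" and b: "b \<in> TZ2 (sum_list ds) (UT ds)"
  shows "pmult a b \<in> TZ2 (d + sum_list ds) (UT (d # ds))"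
proof -
  let ?n = "sum_list ds"
  have free: "a \<in> free_alg" "b \<in> free_alg" using a b by (auto simp: TZ2_def)
  have "peval (d + ?n) \<Phi> (pmult a b) = mzero" if \<Phi>: "graded_subst (UT (d # ds)) \<Phi>" for \<Phi>
  proof -
    have deg: "\<exists>b. \<Phi> y \<in> mdeg b (UT (d # ds))" for y
      using \<Phi> by (cases y) (auto simp: graded_subst_def)
    have lower: "\<Phi> y i j = gzero" if "d \<le> i" "i < d + ?n" "j < d" for y i j
      using deg[of y] mdeg_UT_lower that by blast
    \<comment> \<open>The leading block cut out of \<open>\<Phi>\<close>, since matrices in
      \<open>mat_carrier d\<close> must vanish outside it.\<close>
    define \<phi> where "\<phi> y = (\<lambda>i j. if i < d \<and> j < d then \<Phi> y i j else gzero)" for y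
    have "graded_subst (mat_carrier d) \<phi>"
      using \<Phi> by (auto simp: graded_subst_def \<phi>_def intro: mdeg_UT_head)
    then have "peval d \<phi> a = mzero" using a by (simp add: TZ2_def)
    moreover have "mword d \<Phi> = mword d \<phi>"
      by (intro ext mword_cong[THEN fun_cong, THEN fun_cong, THEN fun_cong]) (simp add: \<phi>_def)
    ultimately have "peval d \<Phi> a = mzero" by (simp add: peval_def)
    then have a0: "peval (d + ?n) \<Phi> a i k = gzero" if "k < d" for i k
      using that peval_block(1,2)[of d ?n \<Phi>, OF lower] by (cases "i < d") (auto simp: mzero_def not_less)
    have "graded_subst (UT ds) (\<lambda>y i j. \<Phi> y (i + d) (j + d))"
      using \<Phi> by (auto simp: graded_subst_def intro: mdeg_UT_tail)
    then have "peval ?n (\<lambda>y i j. \<Phi> y (i + d) (j + d)) b = mzero" using b by (simp add: TZ2_def)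
    then have b0: "peval (d + ?n) \<Phi> b (k + d) j = gzero" if "k < ?n" "j < d + ?n" for k j
      using that peval_block(2)[of d ?n \<Phi> "k + d" j, OF lower]
        peval_block(3)[of d ?n \<Phi> k "j - d", OF lower]
      by (cases "j < d") (auto simp: mzero_def)
    show ?thesis
      unfolding peval_pmult[OF free]
      by (auto simp: mmult_def sum_lessThan_add a0 b0 mzero_def gzero_def[THEN fun_cong] intro!: ext)
  qed
  then show ?thesis by (simp add: TZ2_def pmult_free_alg[OF free])
qed

text \<open>One inclusion is Lewin's criterion applied to the entry functionals of the two diagonal
  blocks; for the other, the right kernel is a subspace that contains all the products.\<close>

lemma TZ2_UT_Cons:
  "TZ2 (d + sum_list ds) (UT (d # ds))
    = (iprod (TZ2 d (mat_carrier d)) (TZ2 (sum_list ds) (UT ds)) :: ('a::field) ncpoly set)"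
    (is "?T = iprod ?I ?J")
proof
  show "?T \<subseteq> iprod ?I ?J"
  proof
    fix f assume f: "f \<in> ?T"
    show "f \<in> iprod ?I ?J"
      unfolding TZ2_eq_kernel[of d] TZ2_eq_kernel[of "sum_list ds"]
    proof (rule orthogonal_in_iprod, unfold TZ2_eq_kernel[symmetric])
      show "pmult g (pword [x]) \<in> ?I" if "g \<in> ?I" for g x
        using that by (rule TZ2_right_ideal) (rule pword_free_alg)
      show "f \<in> ?I" "f \<in> ?J"
        using subsetD[OF TZ2_UT_Cons_subset(1) f] subsetD[OF TZ2_UT_Cons_subset(2) f] by auto
    next
      fix x and \<kappa> \<mu> :: "(nat + nat) list \<Rightarrow> 'a"
      assume "\<kappa> \<in> entry_functionals d (mat_carrier d)" "\<mu> \<in> entry_functionals (sum_list ds) (UT ds)"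
      then show "pairing (\<lambda>w. \<Sum>k<length w. if w ! k = x then \<kappa> (take k w) * \<mu> (drop (Suc k) w) else 0) f = 0"
        unfolding entry_functionals_def by (auto intro!: UT_identity_orthogonal[OF f])
    qed
  qed
next
  have T: "ncpoly.subspace ?T" unfolding TZ2_eq_kernel by (rule subspace_pairing_kernel)
  show "iprod ?I ?J \<subseteq> ?T"
  proof
    fix f assume "f \<in> iprod ?I ?J"
    then show "f \<in> ?T"
    proof induction
      case iprod_zero
      then show ?case using ncpoly.subspace_0[OF T] by (simp add: pzero_eq_0)
    next
      case (iprod_add a b h)
      then show ?case
        unfolding padd_eq_plus by (intro ncpoly.subspace_add[OF T] pmult_TZ2_UT_Cons)
    qed
  qed
qed

theorem theorem7p1:
  fixes ds :: "nat list"
  assumes "ds \<noteq> []" and "\<forall>d\<in>set ds. d > 0"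
  shows "(TZ2 (sum_list ds) (UT ds) :: ('a::field_char_0) ncpoly set)
           = iprods (map (\<lambda>d. TZ2 d (mat_carrier d)) ds)"
  using assms(1)
proof (induction ds rule: list_nonempty_induct)
  case (single d)
  \<comment> \<open>With a single block triangularity is void, so both algebras admit the same
    graded substitutions.\<close>
  show ?case by (simp add: TZ2_def graded_subst_def UT_singleton)
next
  case (cons d ds)
  \<comment> \<open>The recursive equation of \<open>iprods\<close> applies only to a tail that is
    visibly nonempty.\<close>
  then obtain e es where "ds = e # es" by (cases ds) auto
  then have "iprods (map (\<lambda>d. TZ2 d (mat_carrier d)) (d # ds))
      = (iprod (TZ2 d (mat_carrier d)) (iprods (map (\<lambda>d. TZ2 d (mat_carrier d)) ds)) :: 'a ncpoly set)"
    by simp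
  then show ?case using TZ2_UT_Cons[of d ds, where 'a = 'a] cons.IH by simp
qed

end
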